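(* Let $1/2<\alpha<1$, let $a\in C^{1,\alpha}_0(\overline\Omega)$ be real valued with $a>0$ in $\Omega$, let ${\bf F}\in C^{1,\alpha}_0(\overline\Omega;\mathbb R^2)$ be a real valued vector field and $f\in C^{1,\alpha}_0(\overline\Omega)$ a real valued function. Suppose there is $g\in C^\alpha(\Gamma;C^{1,\alpha}(\mathbf S^1))$ with $g\in D_a{\bf F}\cap R_af$ (the attenuated Doppler data of ${\bf F}$ equals the attenuated $X$-ray data of $f$, with the same attenuation $a$). Then ${\bf F}$ is a gradient field, namely ${\bf F}=-\nabla(f/a)$ in $\Omega$.
   Context: $\Omega\subset\mathbb R^2$ is a bounded strictly convex domain with smooth boundary $\Gamma$; $\theta=(\cos\varphi,\sin\varphi)\in\mathbf S^1$. $C^{1,\alpha}_0(\overline\Omega)$ denotes $C^{1,\alpha}$ functions (or vector fields) on $\overline\Omega$ vanishing on $\Gamma$. For $(x,\theta)\in\overline\Omega\times\mathbf S^1$, $\tau_\pm(x,\theta)$ is the distance from $x$ to $\Gamma$ in direction $\pm\theta$ and $x^\pm_\theta=x\pm\tau_\pm(x,\theta)\theta$. With $a$ extended by zero, $Da(x,\theta)=\int_0^\infty a(x+t\theta)dt$. Attenuated $X$-ray data: $R_af$ is the set of functions $g$ on $\Gamma\times\mathbf S^1$ with $$g(x^+_\theta,\theta)-e^{-Da(x^-_\theta,\theta)}g(x^-_\theta,\theta)=\int_{-\tau_-(x,\theta)}^{\tau_+(x,\theta)}f(x+t\theta)e^{-Da(x+t\theta,\theta)}dt\quad\forall(x,\theta)\in\overline\Omega\times\mathbf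 S^1$$ (equivalently, traces of solutions $w$ of $\theta\cdot\nabla w+aw=f$). Attenuated Doppler data: $D_a{\bf F}$ is the set of $g$ satisfying the same identity with $f$ replaced by $\theta\cdot{\bf F}$ (equivalently, traces of solutions $u$ of $\theta\cdot\nabla u+au=\theta\cdot{\bf F}$). *)

theory Defs
  imports "HOL-Analysis.Analysis"
begin

type_synonym pt = "real^2"

coinductive smooth_fun :: "(real^2 \<Rightarrow> real) \<Rightarrow> bool" where
  "(\<forall>x. f differentiable (at x)) \<Longrightarrow>
   (\<forall>i. smooth_fun (\<lambda>x. frechet_derivative f (at x) (axis i 1))) \<Longrightarrow> smooth_fun f"

definition strictly_convex_smooth_domain :: "pt set \<Rightarrow> bool" where
  "strictly_convex_smooth_domain \<Omega> \<longleftrightarrow>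
     open \<Omega> \<and> bounded \<Omega> \<and> \<Omega> \<noteq> {} \<and> convex \<Omega> \<and>
     (\<forall>x\<in>closure \<Omega>. \<forall>y\<in>closure \<Omega>. x \<noteq> y \<longrightarrow> open_segment x y \<subseteq> \<Omega>) \<and>
     (\<exists>\<rho>. smooth_fun \<rho> \<and> \<Omega> = {x. \<rho> x < 0} \<and> frontier \<Omega> = {x. \<rho> x = 0} \<and>
          (\<forall>x. \<rho> x = 0 \<longrightarrow> frechet_derivative \<rho> (at x) \<noteq> (\<lambda>h. 0)))"

definition C1alpha0 :: "pt set \<Rightarrow> real \<Rightarrow> (pt \<Rightarrow> real) \<Rightarrow> bool" where
  "C1alpha0 \<Omega> \<alpha> u \<longleftrightarrow>
     continuous_on (closure \<Omega>) u \<and>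
     (\<forall>x\<in>frontier \<Omega>. u x = 0) \<and>
     (\<exists>u' C. (\<forall>x\<in>\<Omega>. (u has_derivative u' x) (at x)) \<and>
        (\<forall>x\<in>\<Omega>. \<forall>y\<in>\<Omega>. \<forall>h. \<bar>u' x h - u' y h\<bar> \<le> C * norm h * dist x y powr \<alpha>))"

definition C1alpha0_vec :: "pt set \<Rightarrow> real \<Rightarrow> (pt \<Rightarrow> real^2) \<Rightarrow> bool" where
  "C1alpha0_vec \<Omega> \<alpha> F \<longleftrightarrow> (\<forall>i. C1alpha0 \<Omega> \<alpha> (\<lambda>x. F x $ i))"

definition dirvec :: "real \<Rightarrow> pt" where
  "dirvec \<phi> = vector [cos \<phi>, sin \<phi>]"

definition C_alpha_C1alpha_S1 :: "pt set \<Rightarrow> real \<Rightarrow> (pt \<Rightarrow> pt \<Rightarrow> real) \<Rightarrow> bool" where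
  "C_alpha_C1alpha_S1 \<Gamma> \<alpha> g \<longleftrightarrow>
     (\<exists>g'. (\<forall>x\<in>\<Gamma>. \<forall>\<phi>. ((\<lambda>\<psi>. g x (dirvec \<psi>)) has_real_derivative g' x \<phi>) (at \<phi>)) \<and>
       (\<forall>x\<in>\<Gamma>. \<exists>C. \<forall>\<phi> \<psi>. \<bar>g x (dirvec \<phi>)\<bar> \<le> C \<and> \<bar>g' x \<phi>\<bar> \<le> C \<and>
            \<bar>g' x \<phi> - g' x \<psi>\<bar> \<le> C * \<bar>\<phi> - \<psi>\<bar> powr \<alpha>) \<and>
       (\<exists>C. \<forall>x\<in>\<Gamma>. \<forall>y\<in>\<Gamma>. \<forall>\<phi> \<psi>.
            \<bar>g x (dirvec \<phi>) - g y (dirvec \<phi>)\<bar> \<le> C * dist x y powr \<alpha> \<and>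
            \<bar>g' x \<phi> - g' y \<phi>\<bar> \<le> C * dist x y powr \<alpha> \<and>
            \<bar>(g' x \<phi> - g' y \<phi>) - (g' x \<psi> - g' y \<psi>)\<bar>
               \<le> C * dist x y powr \<alpha> * \<bar>\<phi> - \<psi>\<bar> powr \<alpha>))"

definition tau_plus :: "pt set \<Rightarrow> pt \<Rightarrow> pt \<Rightarrow> real" where
  "tau_plus \<Omega> x \<theta> = Sup {t. t \<ge> 0 \<and> x + t *\<^sub>R \<theta> \<in> closure \<Omega>}"

definition tau_minus :: "pt set \<Rightarrow> pt \<Rightarrow> pt \<Rightarrow> real" where
  "tau_minus \<Omega> x \<theta> = tau_plus \<Omega> x (- \<theta>)"

definition x_plus :: "pt set \<Rightarrow> pt \<Rightarrow> pt \<Rightarrow> pt" where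
  "x_plus \<Omega> x \<theta> = x + tau_plus \<Omega> x \<theta> *\<^sub>R \<theta>"

definition x_minus :: "pt set \<Rightarrow> pt \<Rightarrow> pt \<Rightarrow> pt" where
  "x_minus \<Omega> x \<theta> = x - tau_minus \<Omega> x \<theta> *\<^sub>R \<theta>"

definition Dbeam :: "pt set \<Rightarrow> (pt \<Rightarrow> real) \<Rightarrow> pt \<Rightarrow> pt \<Rightarrow> real" where
  "Dbeam \<Omega> a x \<theta> = integral {0..} (\<lambda>t. if x + t *\<^sub>R \<theta> \<in> \<Omega> then a (x + t *\<^sub>R \<theta>) else 0)"

definition att_data :: "pt set \<Rightarrow> (pt \<Rightarrow> real) \<Rightarrow> (pt \<Rightarrow> pt \<Rightarrow> real) \<Rightarrow> (pt \<Rightarrow> pt \<Rightarrow> real) \<Rightarrow> bool" where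
  "att_data \<Omega> a h g \<longleftrightarrow>
     (\<forall>x\<in>closure \<Omega>. \<forall>\<theta>. norm \<theta> = 1 \<longrightarrow>
        g (x_plus \<Omega> x \<theta>) \<theta> - exp (- Dbeam \<Omega> a (x_minus \<Omega> x \<theta>) \<theta>) * g (x_minus \<Omega> x \<theta>) \<theta>
        = integral {- tau_minus \<Omega> x \<theta> .. tau_plus \<Omega> x \<theta>}
            (\<lambda>t. h (x + t *\<^sub>R \<theta>) \<theta> * exp (- Dbeam \<Omega> a (x + t *\<^sub>R \<theta>) \<theta>)))"

definition in_Ra :: "pt set \<Rightarrow> (pt \<Rightarrow> real) \<Rightarrow> (pt \<Rightarrow> real) \<Rightarrow> (pt \<Rightarrow> pt \<Rightarrow> real) \<Rightarrow> bool" where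
  "in_Ra \<Omega> a f g \<longleftrightarrow> att_data \<Omega> a (\<lambda>y \<theta>. f y) g"

definition in_Da :: "pt set \<Rightarrow> (pt \<Rightarrow> real) \<Rightarrow> (pt \<Rightarrow> real^2) \<Rightarrow> (pt \<Rightarrow> pt \<Rightarrow> real) \<Rightarrow> bool" where
  "in_Da \<Omega> a F g \<longleftrightarrow> att_data \<Omega> a (\<lambda>y \<theta>. \<theta> \<bullet> F y) g"

end

theory Submission
  imports Defs
begin

text \<open>
  Write \<open>X\<close> for the derivative along \<open>\<theta> = dirvec \<phi>\<close>. Subtracting the two transport equations gives a
  real function \<open>v\<close> with \<open>X v + a v = \<theta> \<bullet> F - f\<close> that vanishes outside \<open>\<Omega>\<close>, because both data agree; we
  show that \<open>v\<close> does not depend on \<open>\<phi>\<close>. There is \<open>h\<close> with \<open>X h = a\<close> having only nonnegative Fourier modes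
  in \<open>\<phi>\<close>: minus the odd part of the beam transform of \<open>a\<close>, plus \<open>\<i>\<close> times the Hilbert transform of the
  beam transform on the circle, which is constant along lines. Then \<open>p = exp h * v\<close> solves
  \<open>X p = exp h * (\<theta> \<bullet> F - f)\<close>, whose right-hand side has only modes \<open>\<ge> - 1\<close>. After a Fourier transform
  in \<open>x\<close> this says that the moduli of the modes \<open>n - 1\<close> and \<open>n + 1\<close> of \<open>p\<close> agree for \<open>n \<le> - 2\<close>; as the modes
  tend to \<open>0\<close>, all negative modes of \<open>p\<close> vanish, hence so do those of \<open>v = exp (- h) * p\<close>. Since \<open>v\<close> is
  real, only its mode \<open>0\<close> remains. Comparing the equation at \<open>\<theta>\<close> and \<open>- \<theta>\<close> then gives \<open>a v = - f\<close> and
  \<open>\<nabla> v = F\<close>.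
\<close>

section \<open>Fourier coefficients on the circle\<close>

text \<open>The attenuation term mixes each angular mode of \<open>v\<close> with its neighbours;
  the factor \<open>exp h\<close> removes that term without creating negative modes. Since the beam
  transform has derivative \<open>- a\<close> along its ray, any function constant along lines may
  be added to \<open>- beam\<close>. Half the integral of \<open>a\<close> over the whole line
  cancels the even modes. The odd negative ones are cancelled by \<open>\<i>\<close> times a
  convolution with 1 / sin, whose multiplier on them is \<open>- \<i>\<close>. That this convolution
  is constant along lines is the least formal point: in terms of the distance to the line and the
  cotangent of the angle, moving the base point along the line is a mere translation. Lack of
  smoothness shapes the rest. After extension by zero \<open>a\<close> is only Lipschitz, the
  sources are only continuous, and \<open>v\<close> is controlled along single rays. So the
  transport equation is used in integrated form on lines, and its Fourier transform comes from
  finite shifts instead of differentiation.\<close>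

definition fcoeff :: "(real \<Rightarrow> complex) \<Rightarrow> int \<Rightarrow> complex" where
  "fcoeff f k = integral {0..2*pi} (\<lambda>\<phi>. f \<phi> * cis (- (of_int k * \<phi>)))"

text \<open>The set \<open>S\<close> restricts the frequencies, so that \<open>{0..}\<close> and
  \<open>{..<0}\<close> give the two halves used for one-sided spectra.\<close>

inductive trig_poly :: "int set \<Rightarrow> (real \<Rightarrow> complex) \<Rightarrow> bool" for S where
  mono: "k \<in> S \<Longrightarrow> trig_poly S (\<lambda>\<phi>. c * cis (of_int k * \<phi>))"
| add: "trig_poly S f \<Longrightarrow> trig_poly S g \<Longrightarrow> trig_poly S (\<lambda>\<phi>. f \<phi> + g \<phi>)"

lemma continuous_on_cis_comp [continuous_intros]:
  "continuous_on X f \<Longrightarrow> continuous_on X (\<lambda>x. cis (f x))"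
  by (simp add: cis_conv_exp continuous_intros)

lemma trig_poly_continuous: "trig_poly S T \<Longrightarrow> continuous_on X T"
  by (induction rule: trig_poly.induct) (auto intro!: continuous_intros)

lemma fcoeff_integrable:
  "continuous_on UNIV f \<Longrightarrow> (\<lambda>\<phi>. f \<phi> * cis (- (of_int k * \<phi>))) integrable_on {0..2*pi}"
  by (drule continuous_on_subset[OF _ subset_UNIV, of _ "{0..2*pi}"])
     (intro integrable_continuous_real continuous_intros)

lemma fcoeff_add:
  "continuous_on UNIV f \<Longrightarrow> continuous_on UNIV g \<Longrightarrow>
    fcoeff (\<lambda>\<phi>. f \<phi> + g \<phi>) k = fcoeff f k + fcoeff g k"
  unfolding fcoeff_def distrib_right by (intro integral_add fcoeff_integrable)

lemma fcoeff_cmult: "fcoeff (\<lambda>\<phi>. c * f \<phi>) k = c * fcoeff f k"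
  unfolding fcoeff_def by (simp add: mult.assoc)

lemma fcoeff_diff:
  "continuous_on UNIV f \<Longrightarrow> continuous_on UNIV g \<Longrightarrow>
    fcoeff (\<lambda>\<phi>. f \<phi> - g \<phi>) k = fcoeff f k - fcoeff g k"
  unfolding fcoeff_def left_diff_distrib by (intro integral_diff fcoeff_integrable)

text \<open>The components of \<open>dirvec\<close> have frequencies 1 and -1 only, so this shift
  turns angular factors into relations between neighbouring modes.\<close>

lemma fcoeff_modulate: "fcoeff (\<lambda>\<phi>. c * cis (of_int j * \<phi>) * f \<phi>) k = c * fcoeff f (k - j)"
proof -
  have "c * cis (of_int j * \<phi>) * f \<phi> * cis (- (of_int k * \<phi>))
      = c * (f \<phi> * cis (- (of_int (k - j) * \<phi>)))" for \<phi>
  proof -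
    have "cis (of_int j * \<phi>) * cis (- (of_int k * \<phi>)) = cis (- (of_int (k - j) * \<phi>))"
      by (simp add: cis_mult algebra_simps)
    then show ?thesis by (metis (no_types, opaque_lifting) mult.assoc mult.commute)
  qed
  then show ?thesis unfolding fcoeff_def by (simp only: integral_mult_right)
qed

lemma fcoeff_one: "fcoeff (\<lambda>\<phi>. 1) k = (if k = 0 then 2 * pi else 0)"
proof (cases "k = 0")
  case False
  have "((\<lambda>\<phi>. cis (- (of_int k * \<phi>))) has_integral
      (\<i> / of_int k * cis (- (of_int k * (2*pi))) - \<i> / of_int k * cis (- (of_int k * 0)))) {0..2*pi}"
  proof (intro fundamental_theorem_of_calculus)
    fix x assume "x \<in> {0..2*pi}"
    have "((\<lambda>z. \<i> / of_int k * exp (\<i> * (- (of_int k * z)))) has_field_derivative exp (\<i> * (- (of_int k * of_real x)))) (at (of_real x))"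
      using False by (auto intro!: derivative_eq_intros simp: field_simps)
    from has_vector_derivative_real_field[OF this]
    show "((\<lambda>x. \<i> / of_int k * cis (- (of_int k * x))) has_vector_derivative cis (- (of_int k * x))) (at x within {0..2*pi})"
      by (simp add: cis_conv_exp)
  qed simp
  moreover have "cis (- (of_int k * (2*pi))) = 1"
    using cis_multiple_2pi[of "- of_int k"] by (simp add: algebra_simps)
  ultimately show ?thesis using False unfolding fcoeff_def by (auto dest: integral_unique)
qed (simp add: fcoeff_def scaleR_conv_of_real)

lemma fcoeff_monomial: "fcoeff (\<lambda>\<phi>. c * cis (of_int j * \<phi>)) k = (if j = k then complex_of_real (2 * pi) * c else 0)"
  using fcoeff_modulate[of c j "\<lambda>_. 1" k] by (simp add: fcoeff_one mult.commute split: if_splits)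

lemma fcoeff_trig_poly_finite: "trig_poly S T \<Longrightarrow> \<exists>N. \<forall>k. \<bar>k\<bar> > N \<longrightarrow> fcoeff T k = 0"
proof (induction rule: trig_poly.induct)
  case (mono k c)
  show ?case by (rule exI[of _ "\<bar>k\<bar>"]) (auto simp: fcoeff_monomial)
next
  case (add f g)
  then obtain N M where "\<forall>k. \<bar>k\<bar> > N \<longrightarrow> fcoeff f k = 0" "\<forall>k. \<bar>k\<bar> > M \<longrightarrow> fcoeff g k = 0" by blast
  then show ?case
    by (intro exI[of _ "max N M"]) (auto simp: fcoeff_add[OF trig_poly_continuous trig_poly_continuous, OF add(1,2)])
qed

section \<open>Uniform approximation by trigonometric polynomials\<close>

lemma trig_poly_mult: "trig_poly UNIV f \<Longrightarrow> trig_poly UNIV g \<Longrightarrow> trig_poly UNIV (\<lambda>\<phi>. f \<phi> * g \<phi>)"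
proof (induction arbitrary: g rule: trig_poly.induct)
  case (mono k c)
  from mono(2) show ?case
  proof (induction rule: trig_poly.induct)
    case (mono j d)
    have "(\<lambda>\<phi>. c * cis (of_int k * \<phi>) * (d * cis (of_int j * \<phi>)))
        = (\<lambda>\<phi>. (c * d) * cis (of_int (k + j) * \<phi>))"
      by (auto simp: fun_eq_iff cis_mult[symmetric] algebra_simps)
    then show ?case by (simp only: trig_poly.mono UNIV_I)
  next
    case (add f g)
    show ?case unfolding distrib_left by (intro trig_poly.add add.IH)
  qed
next
  case (add f1 f2)
  show ?case unfolding distrib_right by (intro trig_poly.add add.IH add.prems)
qed

lemma trig_poly_const: "trig_poly UNIV (\<lambda>\<phi>. c)"
  using trig_poly.mono[of 0 UNIV c] by simp

text \<open>A real polynomial on the plane is built from real-linear functionals; at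
  \<open>cis \<phi>\<close> Euler's formula leaves these only the frequencies 1 and -1.\<close>

lemma trig_poly_of_real_polynomial:
  "real_polynomial_function p \<Longrightarrow> trig_poly UNIV (\<lambda>\<phi>. complex_of_real (p (cis \<phi>)))"
proof (induction rule: real_polynomial_function.induct)
  case (linear f)
  then interpret bounded_linear f .
  have 1: "f (cis \<phi>) = cos \<phi> * f 1 + sin \<phi> * f \<i>" for \<phi>
  proof -
    have "cis \<phi> = cos \<phi> *\<^sub>R 1 + sin \<phi> *\<^sub>R \<i>" by (simp add: complex_eq_iff)
    then show ?thesis by (metis add scaleR real_scaleR_def)
  qed
  have 2: "complex_of_real (f (cis \<phi>))
      = (f 1 - \<i> * f \<i>) / 2 * cis (of_int 1 * \<phi>) + (f 1 + \<i> * f \<i>) / 2 * cis (of_int (-1) * \<phi>)" for \<phi>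
    unfolding 1 by (simp add: complex_eq_iff field_simps)
  show ?case unfolding 2 by (intro trig_poly.intros) auto
next
  case (const c)
  then show ?case by (rule trig_poly_const)
next
  case (add f g)
  then show ?case by (simp add: trig_poly.add)
next
  case (mult f g)
  then show ?case by (simp add: trig_poly_mult)
qed

lemma periodic_shift_int:
  fixes f :: "real \<Rightarrow> 'a"
  assumes per: "\<And>x. f (x + 2 * pi) = f x"
  shows "f (x + 2 * pi * of_int n) = f x"
proof (induction n rule: int_induct[where k=0])
  case (step1 i)
  then show ?case using per[of "x + 2 * pi * of_int i"] by (simp add: algebra_simps)
next
  case (step2 i)
  then show ?case using per[of "x + 2 * pi * of_int (i - 1)"] by (simp add: algebra_simps)
qed simp

lemma periodic_cis_eq:
  fixes f :: "real \<Rightarrow> 'a"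
  assumes per: "\<And>x. f (x + 2 * pi) = f x" and "cis x = cis y"
  shows "f x = f y"
proof -
  have "sin x = sin y \<and> cos x = cos y" using assms(2) by (metis cis.sel)
  then obtain n::int where "x = y + 2 * pi * n"
    using sin_cos_eq_iff[of x y] by auto
  then show ?thesis using periodic_shift_int[of f y n] per by simp
qed

text \<open>A periodic function descends to the unit circle through \<open>Arg\<close>, where
  Stone-Weierstrass applies; care is needed only at the branch cut.\<close>

lemma trig_poly_approx:
  assumes cont: "continuous_on UNIV f" and per: "\<And>\<phi>. f (\<phi> + 2 * pi) = f \<phi>" and "e > 0"
  obtains T where "trig_poly UNIV T" "\<And>\<phi>. norm (f \<phi> - T \<phi>) < e"
proof -
  define F where "F = (\<lambda>z. f (Arg z))"
  have F_cis: "F (cis \<phi>) = f \<phi>" for \<phi>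
    unfolding F_def using cis_Arg[of "cis \<phi>"] by (intro periodic_cis_eq[of f, OF per]) (simp add: sgn_div_norm)
  have contf: "isCont f x" for x using cont by (simp add: continuous_on_eq_continuous_at)
  have "isCont F z" if "norm z = 1" for z
  proof (cases "z \<in> \<real>\<^sub>\<le>\<^sub>0")
    case False
    then show ?thesis unfolding F_def
      by (intro isCont_o2[OF continuous_at_Arg] contf)
  next
    case True
    then have nz: "- z \<notin> \<real>\<^sub>\<le>\<^sub>0" "z \<noteq> 0" using that
      by (auto simp: complex_nonpos_Reals_iff cmod_def)
    \<comment> \<open>On the cut \<open>Arg\<close> jumps, but \<open>Arg (- w) + pi\<close> is
      continuous there and differs from \<open>Arg w\<close> by a multiple of \<open>2 * pi\<close>,
      which \<open>f\<close> does not see.\<close>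
    have "F w = f (Arg (- w) + pi)" if "w \<noteq> 0" for w
      unfolding F_def using that
      by (intro periodic_cis_eq[of f, OF per])
         (simp add: cis_Arg cis_mult[symmetric] sgn_minus)
    then have ev: "eventually (\<lambda>w. F w = f (Arg (- w) + pi)) (nhds z)"
      using t1_space_nhds[OF nz(2)] by (rule eventually_mono[rotated])
    have "isCont (\<lambda>w. Arg (- w)) z"
      by (rule isCont_o2[where f=uminus and g=Arg]) (simp, rule continuous_at_Arg[OF nz(1)])
    then have "isCont (\<lambda>w. f (Arg (- w) + pi)) z"
      by (intro isCont_o2[OF _ contf] continuous_intros)
    then show ?thesis using isCont_cong[OF ev] by simp
  qed
  then have "continuous_on (sphere 0 1) F" by (auto simp: intro!: continuous_at_imp_continuous_on)
  from Stone_Weierstrass_polynomial_function[OF compact_sphere this \<open>e > 0\<close>]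
  obtain g where g: "polynomial_function g" "\<And>z. norm z = 1 \<Longrightarrow> norm (F z - g z) < e" by auto
  have "real_polynomial_function (Re \<circ> g)" "real_polynomial_function (Im \<circ> g)"
    using g(1) bounded_linear_Re bounded_linear_Im unfolding polynomial_function_def by blast+
  from this[THEN trig_poly_of_real_polynomial]
  have "trig_poly UNIV (\<lambda>\<phi>. complex_of_real ((Re \<circ> g) (cis \<phi>)) + \<i> * complex_of_real ((Im \<circ> g) (cis \<phi>)))"
    by (intro trig_poly.add trig_poly_mult[OF trig_poly_const])
  then have "trig_poly UNIV (\<lambda>\<phi>. g (cis \<phi>))" by (simp flip: complex_eq)
  moreover have "norm (f \<phi> - g (cis \<phi>)) < e" for \<phi> using g(2)[of "cis \<phi>"] by (simp add: F_cis)
  ultimately show ?thesis using that by blast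
qed

lemma trig_poly_split:
  "trig_poly UNIV T \<Longrightarrow> \<exists>P N. trig_poly {0..} P \<and> trig_poly {..<0} N \<and> (\<forall>\<phi>. T \<phi> = P \<phi> + N \<phi>)"
proof (induction rule: trig_poly.induct)
  case (mono k c)
  have z: "trig_poly {0..} (\<lambda>_. 0)" "trig_poly {..<0} (\<lambda>_. 0)"
    using trig_poly.mono[of 0 "{0..}" 0] trig_poly.mono[of "-1" "{..<0}" 0] by auto
  show ?case
  proof (cases "k \<ge> 0")
    case True
    then show ?thesis using z
      by (intro exI[of _ "\<lambda>\<phi>. c * cis (of_int k * \<phi>)"] exI[of _ "\<lambda>_. 0"]) (auto intro: trig_poly.mono)
  next
    case False
    then show ?thesis using z
      by (intro exI[of _ "\<lambda>\<phi>. c * cis (of_int k * \<phi>)"] exI[of _ "\<lambda>_. 0"]) (auto intro: trig_poly.mono)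
  qed
next
  case (add f g)
  then obtain P N P' N' where "trig_poly {0..} P" "trig_poly {..<0} N" "\<forall>\<phi>. f \<phi> = P \<phi> + N \<phi>"
     "trig_poly {0..} P'" "trig_poly {..<0} N'" "\<forall>\<phi>. g \<phi> = P' \<phi> + N' \<phi>" by blast
  then show ?case
    by (intro exI[of _ "\<lambda>\<phi>. P \<phi> + P' \<phi>"] exI[of _ "\<lambda>\<phi>. N \<phi> + N' \<phi>"]) (auto intro: trig_poly.add)
qed

section \<open>Orthogonality, uniqueness, and products of functions without negative modes\<close>

lemma integral_mult_cnj_trig_poly:
  assumes "trig_poly S T" "continuous_on UNIV f" "\<And>k. k \<in> S \<Longrightarrow> fcoeff f k = 0"
  shows "integral {0..2*pi} (\<lambda>\<phi>. f \<phi> * cnj (T \<phi>)) = 0"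
  using assms(1)
proof (induction rule: trig_poly.induct)
  case (mono k c)
  have "integral {0..2*pi} (\<lambda>\<phi>. f \<phi> * cnj (c * cis (of_int k * \<phi>))) = cnj c * fcoeff f k"
    unfolding fcoeff_def by (simp add: cis_cnj algebra_simps flip: integral_mult_right)
  then show ?case using assms(3) mono by simp
next
  case (add g h)
  have "continuous_on {0..2*pi} f" using assms(2) continuous_on_subset by blast
  with add show ?case
    by (simp add: distrib_left integral_add integrable_continuous_real trig_poly_continuous continuous_intros)
qed

lemma nonpos_if_le_eps_mult:
  fixes x C :: real
  assumes "C \<ge> 0" "\<And>e. e > 0 \<Longrightarrow> x \<le> e * C"
  shows "x \<le> 0"
proof (rule field_le_epsilon)
  fix e :: real assume "e > 0"
  have "x \<le> e / (C + 1) * C" by (rule assms(2)) (use assms(1) \<open>e > 0\<close> in simp)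
  also have "\<dots> \<le> e" using assms(1) \<open>e > 0\<close> by (simp add: field_simps)
  finally show "x \<le> 0 + e" by simp
qed

text \<open>If all coefficients vanish, \<open>f\<close> is orthogonal to every trigonometric
  polynomial. Replacing one factor of the squared modulus by \<open>f - T\<close> bounds its
  integral by \<open>e\<close> times the L1 norm of \<open>f\<close>.\<close>

lemma fcoeff_unique:
  assumes cont: "continuous_on UNIV f" and per: "\<And>\<phi>. f (\<phi> + 2 * pi) = f \<phi>"
    and zero: "\<And>k. fcoeff f k = 0"
  shows "f \<phi> = 0"
proof -
  have c: "continuous_on {0..2*pi} f" using cont continuous_on_subset by blast
  define M where "M = integral {0..2*pi} (\<lambda>\<phi>. norm (f \<phi>))"
  have M: "M \<ge> 0" unfolding M_def by (intro integral_nonneg integrable_continuous_real continuous_intros c) auto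
  have ff: "integral {0..2*pi} (\<lambda>\<phi>. f \<phi> * cnj (f \<phi>)) = complex_of_real (integral {0..2*pi} (\<lambda>\<phi>. (norm (f \<phi>))\<^sup>2))"
    unfolding complex_norm_square[symmetric]
    by (rule integral_linear[OF _ bounded_linear_of_real, unfolded o_def])
       (intro integrable_continuous_real continuous_intros c)
  have "norm (integral {0..2*pi} (\<lambda>\<phi>. f \<phi> * cnj (f \<phi>))) \<le> e * M" if "e > 0" for e
  proof -
    obtain T where T: "trig_poly UNIV T" "\<And>\<phi>. norm (f \<phi> - T \<phi>) < e"
      using trig_poly_approx[OF cont per \<open>e > 0\<close>] by blast
    have "integral {0..2*pi} (\<lambda>\<phi>. f \<phi> * cnj (f \<phi>)) = integral {0..2*pi} (\<lambda>\<phi>. f \<phi> * cnj (f \<phi> - T \<phi>))"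
      using integral_mult_cnj_trig_poly[OF T(1) cont] zero trig_poly_continuous[OF T(1)] c
      by (simp add: right_diff_distrib integral_diff integrable_continuous_real continuous_intros)
    also have "norm \<dots> \<le> integral {0..2*pi} (\<lambda>\<phi>. e * norm (f \<phi>))"
    proof (intro integral_norm_bound_integral integrable_continuous_real continuous_intros c trig_poly_continuous[OF T(1)])
      fix x
      show "norm (f x * cnj (f x - T x)) \<le> e * norm (f x)"
        using mult_left_mono[OF less_imp_le[OF T(2)[of x]], of "norm (f x)"] by (simp add: norm_mult mult.commute del: complex_cnj_diff)
    qed
    finally show ?thesis unfolding M_def by simp
  qed
  from nonpos_if_le_eps_mult[OF M this]
  have "integral {0..2*pi} (\<lambda>\<phi>. (norm (f \<phi>))\<^sup>2) = 0" unfolding ff by simp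
  then have *: "f \<phi> = 0" if "\<phi> \<in> {0..2*pi}" for \<phi>
    using integral_cbox_eq_0_iff[of 0 "2*pi" "\<lambda>\<phi>. (norm (f \<phi>))\<^sup>2"] that
    unfolding box_real cbox_interval
    using not_le[of pi 0] pi_gt_zero by (auto simp: continuous_on_power[OF continuous_on_norm[OF c]])
  have "\<exists>y\<in>{0..2*pi}. cis y = cis \<phi>"
    using Arg2pi[of "cis \<phi>"] by (intro bexI[of _ "Arg2pi (cis \<phi>)"]) (auto simp: cis_conv_exp is_Arg_def intro: less_imp_le)
  then show ?thesis using * periodic_cis_eq[of f, OF per] by metis
qed

text \<open>For a polynomial \<open>f\<close> with frequencies \<open>\<ge> 0\<close> this is
  \<open>fcoeff_modulate\<close>. Dropping the negative part of a uniform approximation is not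
  controlled in the sup norm, but it is in the L2 norm, where the two halves are orthogonal;
  Cauchy-Schwarz then handles the product.\<close>

lemma fcoeff_nonneg_mult:
  assumes f: "continuous_on UNIV f" "\<And>\<phi>. f (\<phi> + 2 * pi) = f \<phi>" "\<And>k. k < 0 \<Longrightarrow> fcoeff f k = 0"
    and g: "continuous_on UNIV g" "\<And>k. k < 0 \<Longrightarrow> fcoeff g k = 0"
    and "k < 0"
  shows "fcoeff (\<lambda>\<phi>. f \<phi> * g \<phi>) k = 0"
proof -
  have cf: "continuous_on {0..2*pi} f" and cg: "continuous_on {0..2*pi} g"
    using f g continuous_on_subset by blast+
  define M where "M = integral {0..2*pi} (\<lambda>\<phi>. (norm (g \<phi>))\<^sup>2)"
  have M: "M \<ge> 0" unfolding M_def by (intro integral_nonneg integrable_continuous_real continuous_intros cg) auto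
  have "norm (fcoeff (\<lambda>\<phi>. f \<phi> * g \<phi>) k) \<le> e * (pi + M)" if "e > 0" for e
  proof -
    obtain T where T: "trig_poly UNIV T" "\<And>\<phi>. norm (f \<phi> - T \<phi>) < e"
      using trig_poly_approx[OF f(1,2) \<open>e > 0\<close>] by blast
    obtain P N where P: "trig_poly {0..} P" and N: "trig_poly {..<0} N" and PN: "\<And>\<phi>. T \<phi> = P \<phi> + N \<phi>"
      using trig_poly_split[OF T(1)] by blast
    note cP = trig_poly_continuous[OF P] and cN = trig_poly_continuous[OF N]
    have P0: "fcoeff P k = 0" if "k < 0" for k
      using P that
      by (induction rule: trig_poly.induct) (auto simp: fcoeff_monomial fcoeff_add trig_poly_continuous)
    have PG: "fcoeff (\<lambda>\<phi>. P \<phi> * g \<phi>) k = 0"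
      using P
    proof (induction rule: trig_poly.induct)
      case (mono j c)
      then show ?case using g(2)[of "k - j"] \<open>k < 0\<close> by (simp add: fcoeff_modulate)
    next
      case (add u w)
      then show ?case
        by (simp add: distrib_right fcoeff_add g(1) trig_poly_continuous continuous_intros)
    qed
    define r where "r = (\<lambda>\<phi>. f \<phi> - P \<phi>)"
    have cr: "continuous_on X r" for X unfolding r_def
      using continuous_on_subset[OF f(1)] by (intro continuous_intros cP) auto
    have orth: "integral {0..2*pi} (\<lambda>\<phi>. r \<phi> * cnj (N \<phi>)) = 0"
      using P0 f(3) by (intro integral_mult_cnj_trig_poly[OF N cr]) (simp add: r_def fcoeff_diff f(1) cP)
    \<comment> \<open>Pythagoras: \<open>r\<close> has no negative modes, so it is orthogonal to
      \<open>N\<close>, and \<open>r - N = f - T\<close> is uniformly small.\<close>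
    have "integral {0..2*pi} (\<lambda>\<phi>. (norm (r \<phi>))\<^sup>2)
        \<le> integral {0..2*pi} (\<lambda>\<phi>. (norm (r \<phi> - N \<phi>))\<^sup>2 + 2 * Re (r \<phi> * cnj (N \<phi>)))"
    proof (intro integral_le integrable_continuous_real continuous_intros cr cN)
      fix x
      have "(norm (r x - N x))\<^sup>2 + 2 * Re (r x * cnj (N x)) = (norm (r x))\<^sup>2 + (norm (N x))\<^sup>2"
        unfolding cmod_power2 by (simp add: power2_eq_square algebra_simps)
      then show "(norm (r x))\<^sup>2 \<le> (norm (r x - N x))\<^sup>2 + 2 * Re (r x * cnj (N x))" by simp
    qed
    also have "\<dots> = integral {0..2*pi} (\<lambda>\<phi>. (norm (r \<phi> - N \<phi>))\<^sup>2)
        + 2 * integral {0..2*pi} (\<lambda>\<phi>. Re (r \<phi> * cnj (N \<phi>)))"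
      by (subst integral_add, (intro integrable_continuous_real continuous_intros cr cN)+)
         (simp only: integral_mult_right)
    also have "integral {0..2*pi} (\<lambda>\<phi>. Re (r \<phi> * cnj (N \<phi>))) = Re (integral {0..2*pi} (\<lambda>\<phi>. r \<phi> * cnj (N \<phi>)))"
      by (rule integral_linear[OF _ bounded_linear_Re, unfolded o_def])
         (intro integrable_continuous_real continuous_intros cr cN)
    also have "integral {0..2*pi} (\<lambda>\<phi>. (norm (r \<phi> - N \<phi>))\<^sup>2) \<le> integral {0..2*pi} (\<lambda>\<phi>. e\<^sup>2)"
    proof (intro integral_le integrable_continuous_real continuous_intros cr cN)
      fix x show "(norm (r x - N x))\<^sup>2 \<le> e\<^sup>2"
        using T(2)[of x] by (intro power_mono) (auto simp: r_def PN algebra_simps)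
    qed
    finally have r2: "integral {0..2*pi} (\<lambda>\<phi>. (norm (r \<phi>))\<^sup>2) \<le> 2 * pi * e\<^sup>2" using orth by simp
    have "fcoeff (\<lambda>\<phi>. f \<phi> * g \<phi>) k = fcoeff (\<lambda>\<phi>. P \<phi> * g \<phi> + r \<phi> * g \<phi>) k"
      by (simp add: r_def algebra_simps)
    also have "\<dots> = fcoeff (\<lambda>\<phi>. r \<phi> * g \<phi>) k"
      using PG by (simp add: fcoeff_add continuous_intros cP cr g(1))
    also have "norm \<dots> \<le> integral {0..2*pi} (\<lambda>\<phi>. (norm (r \<phi>))\<^sup>2 * (1 / (2 * e)) + (norm (g \<phi>))\<^sup>2 * (e / 2))"
      unfolding fcoeff_def
    proof (intro integral_norm_bound_integral integrable_continuous_real continuous_intros cr cg)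
      fix x
      \<comment> \<open>Young's inequality with weight \<open>e\<close>: the integral of the squared
        modulus of \<open>r\<close> is of order \<open>e^2\<close>, so it stays small after division
        by \<open>2 * e\<close>.\<close>
      have "0 \<le> (norm (r x) - e * norm (g x))\<^sup>2 / (2 * e)" using that by simp
      also have "\<dots> = (norm (r x))\<^sup>2 * (1 / (2 * e)) + (norm (g x))\<^sup>2 * (e / 2) - norm (r x) * norm (g x)"
        using that by (simp add: power2_eq_square field_simps)
      finally show "norm (r x * g x * cis (- (of_int k * x))) \<le> (norm (r x))\<^sup>2 * (1 / (2 * e)) + (norm (g x))\<^sup>2 * (e / 2)"
        by (simp add: norm_mult)
    qed
    also have "\<dots> = integral {0..2*pi} (\<lambda>\<phi>. (norm (r \<phi>))\<^sup>2) * (1 / (2 * e)) + M * (e / 2)"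
      unfolding M_def
      by (subst integral_add, (intro integrable_continuous_real continuous_intros cr cg)+)
         (simp only: integral_mult_left)
    also have "\<dots> \<le> 2 * pi * e\<^sup>2 * (1 / (2 * e)) + M * e"
      using r2 that M by (intro add_mono mult_mono) auto
    also have "\<dots> = e * (pi + M)" using that by (simp add: power2_eq_square field_simps)
    finally show ?thesis .
  qed
  from nonpos_if_le_eps_mult[OF _ this] show ?thesis using M pi_ge_zero by simp
qed

text \<open>Powers inherit the one-sided spectrum from products, and the exponential series
  converges uniformly on a period, so coefficients pass to the limit.\<close>

lemma fcoeff_nonneg_exp:
  assumes f: "continuous_on UNIV f" "\<And>\<phi>. f (\<phi> + 2 * pi) = f \<phi>" "\<And>k. k < 0 \<Longrightarrow> fcoeff f k = 0"
    and "k < 0"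
  shows "fcoeff (\<lambda>\<phi>. exp (f \<phi>)) k = 0"
proof -
  have pow: "fcoeff (\<lambda>\<phi>. f \<phi> ^ n) k = 0" if "k < 0" for n k
    using that
  proof (induction n arbitrary: k)
    case 0
    then show ?case by (simp add: fcoeff_one)
  next
    case (Suc n)
    then show ?case
      using fcoeff_nonneg_mult[OF f, of "\<lambda>\<phi>. f \<phi> ^ n" k] by (simp add: f(1) continuous_intros)
  qed
  have cf: "continuous_on {0..2*pi} f" using f continuous_on_subset by blast
  then have "bounded (f ` {0..2*pi})" by (intro compact_imp_bounded compact_continuous_image) auto
  then obtain C where C: "\<And>x. x \<in> {0..2*pi} \<Longrightarrow> norm (f x) \<le> C" unfolding bounded_iff by blast
  define S where "S = (\<lambda>n \<phi>. \<Sum>i<n. (1 / fact i) * f \<phi> ^ i)"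
  have S0: "fcoeff (S n) k = 0" for n
  proof (induction n)
    case (Suc n)
    have "fcoeff (S (Suc n)) k = fcoeff (\<lambda>\<phi>. S n \<phi> + (1 / fact n) * f \<phi> ^ n) k" by (simp add: S_def)
    also have "\<dots> = fcoeff (S n) k + fcoeff (\<lambda>\<phi>. (1 / fact n) * f \<phi> ^ n) k"
      by (rule fcoeff_add) (auto simp: S_def intro!: continuous_intros f(1))
    finally show ?case using Suc pow[OF \<open>k < 0\<close>] by (simp only: fcoeff_cmult) simp
  qed (simp add: S_def fcoeff_def)
  have "uniform_limit {0..2*pi} S (\<lambda>\<phi>. \<Sum>i. (1 / fact i) * f \<phi> ^ i) sequentially"
    unfolding S_def
  proof (rule Weierstrass_m_test)
    show "summable (\<lambda>n. (1 / fact n) * C ^ n)" using summable_exp[of C] by (simp add: inverse_eq_divide)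
    fix n x assume "x \<in> {0..2*pi}"
    then show "norm ((1 / fact n) * f x ^ n) \<le> (1 / fact n) * C ^ n"
      using C[of x] by (auto simp: norm_mult norm_power norm_divide intro!: divide_right_mono power_mono)
  qed
  moreover have "(\<Sum>i. (1 / fact i) * f \<phi> ^ i) = exp (f \<phi>)" for \<phi>
    by (simp add: exp_def scaleR_conv_of_real divide_inverse)
  ultimately have ul: "uniform_limit {0..2*pi} S (\<lambda>\<phi>. exp (f \<phi>)) sequentially" by simp
  have "uniform_limit {0..2*pi} (\<lambda>n \<phi>. S n \<phi> * cis (- (of_int k * \<phi>)))
      (\<lambda>\<phi>. exp (f \<phi>) * cis (- (of_int k * \<phi>))) sequentially"
  proof (rule uniform_limitI)
    fix e :: real assume "e > 0"
    then show "\<forall>\<^sub>F n in sequentially. \<forall>x\<in>{0..2*pi}. dist (S n x * cis (- (of_int k * x))) (exp (f x) * cis (- (of_int k * x))) < e"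
      using uniform_limitD[OF ul] by (simp add: dist_norm norm_mult flip: left_diff_distrib)
  qed
  then obtain I J where IJ: "\<And>n. ((\<lambda>\<phi>. S n \<phi> * cis (- (of_int k * \<phi>))) has_integral I n) {0..2*pi}"
    "((\<lambda>\<phi>. exp (f \<phi>) * cis (- (of_int k * \<phi>))) has_integral J) {0..2*pi}" "I \<longlonglongrightarrow> J"
  proof (rule uniform_limit_integral_cbox[where a=0 and b="2*pi", unfolded cbox_interval])
    show "continuous_on {0..2*pi} (\<lambda>\<phi>. S n \<phi> * cis (- (of_int k * \<phi>)))" for n
      unfolding S_def by (intro continuous_intros cf)
  qed auto
  then have "I = (\<lambda>n. 0)" using S0 integral_unique[OF IJ(1)] by (simp add: fun_eq_iff fcoeff_def)
  with IJ(3) have "J = 0" by (simp add: LIMSEQ_const_iff)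
  then show ?thesis using IJ(2) unfolding fcoeff_def by (metis integral_unique)
qed

section \<open>Decay, reality and rotation of Fourier coefficients\<close>

lemma norm_fcoeff_le:
  assumes "continuous_on UNIV f" "\<And>\<phi>. norm (f \<phi>) \<le> e"
  shows "norm (fcoeff f k) \<le> 2 * pi * e"
proof -
  have "norm (fcoeff f k) \<le> integral {0..2*pi} (\<lambda>\<phi>. e)"
    unfolding fcoeff_def using assms(2)
    by (intro integral_norm_bound_integral fcoeff_integrable assms(1)) (auto simp: norm_mult)
  then show ?thesis by simp
qed

lemma fcoeff_riemann_lebesgue:
  assumes f: "continuous_on UNIV f" "\<And>\<phi>. f (\<phi> + 2 * pi) = f \<phi>" and "e > 0"
  obtains N where "\<And>k. \<bar>k\<bar> > N \<Longrightarrow> norm (fcoeff f k) < e"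
proof -
  \<comment> \<open>The coefficient bound multiplies \<open>e / 10\<close> by \<open>2 * pi\<close>,
    which is less than 8.\<close>
  obtain T where T: "trig_poly UNIV T" "\<And>\<phi>. norm (f \<phi> - T \<phi>) < e / 10"
    using trig_poly_approx[OF f, of "e / 10"] \<open>e > 0\<close> by auto
  obtain N where N: "\<forall>k. \<bar>k\<bar> > N \<longrightarrow> fcoeff T k = 0" using fcoeff_trig_poly_finite[OF T(1)] by blast
  note cT = trig_poly_continuous[OF T(1)]
  have "norm (fcoeff f k) < e" if "\<bar>k\<bar> > N" for k
  proof -
    have "fcoeff f k = fcoeff (\<lambda>\<phi>. f \<phi> - T \<phi>) k" using N that by (simp add: fcoeff_diff f cT)
    also have "norm \<dots> \<le> 2 * pi * (e / 10)"
      using T(2) by (intro norm_fcoeff_le continuous_on_diff f(1) cT less_imp_le)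
    also have "\<dots> < e" using pi_less_4 \<open>e > 0\<close> by simp
    finally show ?thesis .
  qed
  then show ?thesis using that by blast
qed

text \<open>Through this symmetry the vanishing of the negative modes of a real function gives the
  vanishing of the positive ones.\<close>

lemma fcoeff_of_real_minus: "fcoeff (\<lambda>\<phi>. complex_of_real (v \<phi>)) (- k) = cnj (fcoeff (\<lambda>\<phi>. complex_of_real (v \<phi>)) k)"
  unfolding fcoeff_def by (subst Henstock_Kurzweil_Integration.integral_cnj) (simp add: cis_cnj)

text \<open>Checked on monomials and carried over by uniform approximation, which avoids moving the
  interval of integration; two errors of \<open>2 * pi * e\<close> make up the
  \<open>4 * pi\<close>.\<close>

lemma fcoeff_shift:
  assumes f: "continuous_on UNIV f" "\<And>\<phi>. f (\<phi> + 2 * pi) = f \<phi>"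
  shows "fcoeff (\<lambda>\<phi>. f (\<phi> + u)) k = cis (of_int k * u) * fcoeff f k"
proof -
  have shift: "continuous_on UNIV (\<lambda>\<phi>. g (\<phi> + u))" if "continuous_on UNIV g" for g :: "real \<Rightarrow> complex"
    by (rule continuous_on_compose2[OF that]) (auto intro!: continuous_intros)
  have "norm (fcoeff (\<lambda>\<phi>. f (\<phi> + u)) k - cis (of_int k * u) * fcoeff f k) \<le> e * (4 * pi)" if "e > 0" for e
  proof -
    obtain T where T: "trig_poly UNIV T" "\<And>\<phi>. norm (f \<phi> - T \<phi>) < e"
      using trig_poly_approx[OF f \<open>e > 0\<close>] by blast
    note cT = trig_poly_continuous[OF T(1)]
    have "fcoeff (\<lambda>\<phi>. T (\<phi> + u)) k = cis (of_int k * u) * fcoeff T k"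
      using T(1)
    proof (induction rule: trig_poly.induct)
      case (mono j c)
      have "(\<lambda>\<phi>. c * cis (of_int j * (\<phi> + u))) = (\<lambda>\<phi>. (c * cis (of_int j * u)) * cis (of_int j * \<phi>))"
        by (simp add: fun_eq_iff distrib_left flip: cis_mult)
      then show ?case by (simp only: fcoeff_monomial) simp
    next
      case (add g h)
      then show ?case
        by (simp add: fcoeff_add trig_poly_continuous shift distrib_left)
    qed
    then have "fcoeff (\<lambda>\<phi>. f (\<phi> + u)) k - cis (of_int k * u) * fcoeff f k
        = fcoeff (\<lambda>\<phi>. f (\<phi> + u) - T (\<phi> + u)) k - cis (of_int k * u) * fcoeff (\<lambda>\<phi>. f \<phi> - T \<phi>) k"
      by (simp add: fcoeff_diff shift f(1) cT right_diff_distrib)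
    also have "norm \<dots> \<le> norm (fcoeff (\<lambda>\<phi>. f (\<phi> + u) - T (\<phi> + u)) k) + norm (fcoeff (\<lambda>\<phi>. f \<phi> - T \<phi>) k)"
      by (rule order_trans[OF norm_triangle_ineq4]) (simp add: norm_mult)
    also have "\<dots> \<le> 2 * pi * e + 2 * pi * e"
      using T(2) by (intro add_mono norm_fcoeff_le continuous_on_diff shift f(1) cT less_imp_le)
    finally show ?thesis by (simp add: mult_ac)
  qed
  from nonpos_if_le_eps_mult[OF _ this] show ?thesis by simp
qed

section \<open>Injectivity of the Fourier transform\<close>

text \<open>Stone-Weierstrass for an algebra described by its action: \<open>P\<close> collects the
  multipliers that preserve the vanishing of all moments. Cosines belong to it by the product-to-sum
  formula, and the phase \<open>c\<close> keeps sines in the same family. Approximating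
  \<open>u\<close> by multipliers makes the integral of \<open>u * u\<close> vanish.\<close>

lemma zero_if_cos_moments_vanish:
  fixes u :: "'a::euclidean_space \<Rightarrow> real"
  assumes cont: "continuous_on (cbox a b) u" and box: "box a b \<noteq> {}"
    and zero: "\<And>\<xi> c. integral (cbox a b) (\<lambda>x. u x * cos (\<xi> \<bullet> x + c)) = 0"
    and x: "x \<in> cbox a b"
  shows "u x = 0"
proof -
  define Z where "Z w \<longleftrightarrow> continuous_on (cbox a b) w \<and>
      (\<forall>\<xi> c. integral (cbox a b) (\<lambda>x. w x * cos (\<xi> \<bullet> x + c)) = 0)" for w
  define P where "P g \<longleftrightarrow> continuous_on (cbox a b) g \<and> (\<forall>w. Z w \<longrightarrow> Z (\<lambda>x. w x * g x))"
    for g :: "'a \<Rightarrow> real"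
  have cosc: "continuous_on (cbox a b) (\<lambda>x. cos (\<xi> \<bullet> x + c))" for \<xi> c by (intro continuous_intros)
  have Pcos: "P (\<lambda>x. cos (\<eta> \<bullet> x + d))" for \<eta> d
    unfolding P_def
  proof (intro conjI allI impI cosc)
    fix w assume w: "Z w"
    then have cw: "continuous_on (cbox a b) w" by (simp add: Z_def)
    show "Z (\<lambda>x. w x * cos (\<eta> \<bullet> x + d))"
      unfolding Z_def
    proof (intro conjI allI continuous_on_mult cosc cw)
      fix \<xi> c
      have "w x * cos (\<eta> \<bullet> x + d) * cos (\<xi> \<bullet> x + c)
          = (w x * cos ((\<eta> - \<xi>) \<bullet> x + (d - c))) * (1/2) + (w x * cos ((\<eta> + \<xi>) \<bullet> x + (d + c))) * (1/2)" for x
      proof -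
        have "cos (\<eta> \<bullet> x + d) * cos (\<xi> \<bullet> x + c)
            = (cos ((\<eta> - \<xi>) \<bullet> x + (d - c)) + cos ((\<eta> + \<xi>) \<bullet> x + (d + c))) / 2"
          unfolding cos_times_cos by (intro arg_cong2[where f="\<lambda>x y. (cos x + cos y) / 2"])
            (auto simp: inner_left_distrib inner_diff_left)
        then show ?thesis unfolding mult.assoc by (simp only:) (simp add: distrib_left add_divide_distrib)
      qed
      then have "integral (cbox a b) (\<lambda>x. w x * cos (\<eta> \<bullet> x + d) * cos (\<xi> \<bullet> x + c))
          = integral (cbox a b) (\<lambda>x. w x * cos ((\<eta> - \<xi>) \<bullet> x + (d - c))) * (1/2)
          + integral (cbox a b) (\<lambda>x. w x * cos ((\<eta> + \<xi>) \<bullet> x + (d + c))) * (1/2)"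
        by (simp only:, subst integral_add, (intro integrable_continuous continuous_intros cw)+)
           (simp only: integral_mult_left)
      then show "integral (cbox a b) (\<lambda>x. w x * cos (\<eta> \<bullet> x + d) * cos (\<xi> \<bullet> x + c)) = 0"
        using w by (simp add: Z_def)
    qed
  qed
  have Pconst: "P (\<lambda>x. c)" for c
    unfolding P_def
  proof (intro conjI allI impI continuous_on_const)
    fix w assume "Z w"
    moreover have "(\<lambda>x. w x * c * cos (\<xi> \<bullet> x + d)) = (\<lambda>x. w x * cos (\<xi> \<bullet> x + d) * c)" for \<xi> d
      by (simp add: fun_eq_iff)
    ultimately show "Z (\<lambda>x. w x * c)" unfolding Z_def
      by (simp only: integral_mult_left) (simp add: continuous_on_mult continuous_on_const)
  qed
  have Padd: "P (\<lambda>x. f x + g x)" if "P f \<and> P g" for f g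
    unfolding P_def
  proof (intro conjI allI impI)
    show "continuous_on (cbox a b) (\<lambda>x. f x + g x)" using that by (auto simp: P_def intro: continuous_on_add)
    fix w assume "Z w"
    then have Z: "Z (\<lambda>x. w x * f x)" "Z (\<lambda>x. w x * g x)" using that by (auto simp: P_def)
    show "Z (\<lambda>x. w x * (f x + g x))"
      unfolding Z_def distrib_left distrib_right
    proof (intro conjI allI continuous_on_add)
      fix \<xi> c
      show "integral (cbox a b) (\<lambda>x. w x * f x * cos (\<xi> \<bullet> x + c) + w x * g x * cos (\<xi> \<bullet> x + c)) = 0"
        using Z unfolding Z_def
        by (subst integral_add) (auto intro!: integrable_continuous continuous_on_mult cosc)
    qed (use Z in \<open>auto simp: Z_def\<close>)
  qed
  have Pmult: "P (\<lambda>x. f x * g x)" if "P f \<and> P g" for f g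
    using that unfolding P_def by (auto simp: mult.assoc[symmetric] intro: continuous_on_mult)
  have sep: "\<exists>f. P f \<and> f y \<noteq> f z" if "y \<noteq> z" for y z
  proof -
    \<comment> \<open>Scaled so that the phases at \<open>y\<close> and \<open>z\<close> differ by
      exactly \<open>pi\<close>; the cosines are then -1 and 1.\<close>
    define n where "n = (pi / (norm (y - z))\<^sup>2) *\<^sub>R (y - z)"
    have "n \<bullet> (y - z) = pi" using that by (simp add: n_def power2_norm_eq_inner)
    then have "n \<bullet> y - n \<bullet> z = pi" by (simp only: inner_diff_right)
    then have "cos (n \<bullet> y + (- (n \<bullet> z))) \<noteq> cos (n \<bullet> z + (- (n \<bullet> z)))" by simp
    then show ?thesis using Pcos[of n "- (n \<bullet> z)"] by blast
  qed
  have Zu: "Z u" using cont zero by (simp add: Z_def)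
  define M where "M = integral (cbox a b) (\<lambda>x. \<bar>u x\<bar>)"
  have M: "M \<ge> 0" unfolding M_def by (intro integral_nonneg integrable_continuous continuous_intros cont) auto
  have "integral (cbox a b) (\<lambda>x. u x * u x) \<le> e * M" if "e > 0" for e
  proof -
    have "\<exists>g. P g \<and> (\<forall>x\<in>cbox a b. \<bar>u x - g x\<bar> < e)"
      by (rule Stone_Weierstrass_HOL[of "cbox a b" P]) (use Pconst Padd Pmult sep cont that in \<open>auto simp: P_def\<close>)
    then obtain g where g: "P g" "\<And>x. x \<in> cbox a b \<Longrightarrow> \<bar>u x - g x\<bar> < e" by blast
    have cg: "continuous_on (cbox a b) g" using g by (simp add: P_def)
    have "Z (\<lambda>x. u x * g x)" using g Zu by (simp add: P_def)
    \<comment> \<open>At frequency 0 and phase 0 the cosine is 1, so the moment is the plain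
      integral.\<close>
    then have "integral (cbox a b) (\<lambda>x. u x * g x * cos (0 \<bullet> x + 0)) = 0" unfolding Z_def by blast
    then have "integral (cbox a b) (\<lambda>x. u x * u x) = integral (cbox a b) (\<lambda>x. u x * (u x - g x))"
      unfolding right_diff_distrib by (subst integral_diff) (auto intro!: integrable_continuous continuous_on_mult cont cg)
    also have "\<dots> \<le> integral (cbox a b) (\<lambda>x. e * \<bar>u x\<bar>)"
    proof (intro integral_le integrable_continuous continuous_intros cont cg)
      fix x assume "x \<in> cbox a b"
      have "u x * (u x - g x) \<le> \<bar>u x\<bar> * \<bar>u x - g x\<bar>" by (metis abs_ge_self abs_mult)
      also have "\<dots> \<le> \<bar>u x\<bar> * e" using g(2)[OF \<open>x \<in> _\<close>] by (intro mult_left_mono) auto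
      finally show "u x * (u x - g x) \<le> e * \<bar>u x\<bar>" by (simp add: mult.commute)
    qed
    finally show ?thesis by (simp add: M_def)
  qed
  from nonpos_if_le_eps_mult[OF M this]
  have "integral (cbox a b) (\<lambda>x. u x * u x) = 0"
    by (intro antisym integral_nonneg integrable_continuous continuous_on_mult cont) auto
  then show ?thesis
    using integral_cbox_eq_0_iff[of a b "\<lambda>x. u x * u x"] box x by (simp add: continuous_on_mult cont)
qed

text \<open>The hypothesis leaves out frequency 0 because the mode recursion below cancels the
  modulus of the frequency; continuity of the transform restores it. Real and imaginary parts are
  then reduced to cosine moments.\<close>

lemma fourier_transform_injective:
  fixes u :: "'a::euclidean_space \<Rightarrow> complex"
  assumes cont: "continuous_on (cbox a b) u" and box: "box a b \<noteq> {}"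
    and zero: "\<And>\<xi>. \<xi> \<noteq> 0 \<Longrightarrow> integral (cbox a b) (\<lambda>x. u x * cis (- (\<xi> \<bullet> x))) = 0"
    and x: "x \<in> cbox a b"
  shows "u x = 0"
proof -
  have cont2: "continuous_on X (\<lambda>\<xi>. integral (cbox a b) (\<lambda>x. u x * cis (- (\<xi> \<bullet> x))))" for X
    by (rule integral_continuous_on_param)
       (auto simp: case_prod_unfold intro!: continuous_intros continuous_on_compose2[OF cont])
  have zero': "integral (cbox a b) (\<lambda>x. u x * cis (- (\<xi> \<bullet> x))) = 0" for \<xi>
  proof (rule continuous_constant_on_closure[OF cont2, of "- {0}"])
    show "\<xi> \<in> closure (- {0})" by (simp add: closure_complement)
  qed (use zero in auto)
  define J where "J v \<xi> = integral (cbox a b) (\<lambda>x. v x * cos (\<xi> \<bullet> x)) " for v :: "'a \<Rightarrow> real" and \<xi>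
  define K where "K v \<xi> = integral (cbox a b) (\<lambda>x. v x * sin (\<xi> \<bullet> x)) " for v :: "'a \<Rightarrow> real" and \<xi>
  have cRe: "continuous_on (cbox a b) (\<lambda>x. Re (u x))" and cIm: "continuous_on (cbox a b) (\<lambda>x. Im (u x))"
    by (intro continuous_intros cont)+
  have int: "(\<lambda>x. u x * cis (- (\<xi> \<bullet> x))) integrable_on cbox a b" for \<xi>
    by (intro integrable_continuous continuous_intros cont)
  have Re0: "J (\<lambda>x. Re (u x)) \<xi> + K (\<lambda>x. Im (u x)) \<xi> = 0" for \<xi>
  proof -
    have "J (\<lambda>x. Re (u x)) \<xi> + K (\<lambda>x. Im (u x)) \<xi> = integral (cbox a b) (\<lambda>x. Re (u x * cis (- (\<xi> \<bullet> x))))"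
      unfolding J_def K_def
      by (subst integral_add[symmetric]) (auto intro!: integrable_continuous continuous_intros cRe cIm)
    also have "\<dots> = Re (integral (cbox a b) (\<lambda>x. u x * cis (- (\<xi> \<bullet> x))))"
      by (rule integral_linear[OF int bounded_linear_Re, unfolded o_def])
    finally show ?thesis using zero' by simp
  qed
  have Im0: "J (\<lambda>x. Im (u x)) \<xi> - K (\<lambda>x. Re (u x)) \<xi> = 0" for \<xi>
  proof -
    have "J (\<lambda>x. Im (u x)) \<xi> - K (\<lambda>x. Re (u x)) \<xi> = integral (cbox a b) (\<lambda>x. Im (u x * cis (- (\<xi> \<bullet> x))))"
      unfolding J_def K_def
      by (subst integral_diff[symmetric]) (auto intro!: integrable_continuous continuous_intros cRe cIm)
    also have "\<dots> = Im (integral (cbox a b) (\<lambda>x. u x * cis (- (\<xi> \<bullet> x))))"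
      by (rule integral_linear[OF int bounded_linear_Im, unfolded o_def])
    finally show ?thesis using zero' by simp
  qed
  have J_minus: "J v (- \<xi>) = J v \<xi>" and K_minus: "K v (- \<xi>) = - K v \<xi>" for v \<xi>
    by (simp_all add: J_def K_def)
  \<comment> \<open>\<open>J\<close> is even and \<open>K\<close> is odd in the frequency, so the
    relations at \<open>\<xi>\<close> and \<open>- \<xi>\<close> separate the summands.\<close>
  have JK: "J (\<lambda>x. Re (u x)) \<xi> = 0" "K (\<lambda>x. Re (u x)) \<xi> = 0" "J (\<lambda>x. Im (u x)) \<xi> = 0" "K (\<lambda>x. Im (u x)) \<xi> = 0" for \<xi>
    using Re0[of \<xi>] Re0[of "- \<xi>"] Im0[of \<xi>] Im0[of "- \<xi>"] by (auto simp: J_minus K_minus)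
  have expand: "integral (cbox a b) (\<lambda>x. v x * cos (\<xi> \<bullet> x + c)) = J v \<xi> * cos c - K v \<xi> * sin c"
    if "continuous_on (cbox a b) v" for v \<xi> c
  proof -
    have "integral (cbox a b) (\<lambda>x. v x * cos (\<xi> \<bullet> x + c))
        = integral (cbox a b) (\<lambda>x. v x * cos (\<xi> \<bullet> x) * cos c - v x * sin (\<xi> \<bullet> x) * sin c)"
      by (simp add: cos_add algebra_simps)
    also have "\<dots> = J v \<xi> * cos c - K v \<xi> * sin c"
      unfolding J_def K_def
      by (subst integral_diff, (intro integrable_continuous continuous_intros that)+) (simp only: integral_mult_left)
    finally show ?thesis .
  qed
  have "Re (u x) = 0" by (rule zero_if_cos_moments_vanish[OF cRe box _ x]) (simp add: expand cRe JK)
  moreover have "Im (u x) = 0" by (rule zero_if_cos_moments_vanish[OF cIm box _ x]) (simp add: expand cIm JK)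
  ultimately show ?thesis by (simp add: complex_eq_iff)
qed

section \<open>The beam transform and its Hilbert transform\<close>

lemma norm_dirvec [simp]: "norm (dirvec \<phi>) = 1"
  by (simp add: dirvec_def norm_eq_sqrt_inner inner_vec_def sum_2 flip: power2_eq_square)

lemma dirvec_periodic [simp]: "dirvec (\<phi> + 2 * pi) = dirvec \<phi>"
  by (simp add: dirvec_def)

lemma dirvec_plus_pi [simp]: "dirvec (\<phi> + pi) = - dirvec \<phi>"
  by (simp add: dirvec_def vec_eq_iff forall_2)

lemma dirvec_add: "dirvec (\<phi> + u) = cos u *\<^sub>R dirvec \<phi> + sin u *\<^sub>R dirvec (\<phi> + pi / 2)"
  by (simp add: dirvec_def vec_eq_iff forall_2 cos_add sin_add)

lemma dirvec_diff: "dirvec (\<phi> - u) = cos u *\<^sub>R dirvec \<phi> - sin u *\<^sub>R dirvec (\<phi> + pi / 2)"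
  using dirvec_add[of \<phi> "- u"] by simp

lemma norm_dirvec_add_diff: "norm (dirvec (\<phi> + u) - dirvec (\<phi> - u)) = 2 * \<bar>sin u\<bar>"
proof -
  have "dirvec (\<phi> + u) - dirvec (\<phi> - u) = (2 * sin u) *\<^sub>R dirvec (\<phi> + pi / 2)"
    unfolding dirvec_add[of \<phi> u] dirvec_diff by (simp add: vec_eq_iff)
  then show ?thesis by (simp add: abs_mult)
qed

lemma inner_dirvec_self [simp]: "dirvec \<phi> \<bullet> dirvec \<phi> = 1"
  using norm_eq_1[of "dirvec \<phi>"] by simp

lemma inner_dirvec_perp: "dirvec \<phi> \<bullet> dirvec (\<phi> + pi / 2) = 0"
  by (simp add: dirvec_def inner_vec_def sum_2 cos_add sin_add)

lemma dirvec_axis: "dirvec \<phi> = cos \<phi> *\<^sub>R axis 1 1 + sin \<phi> *\<^sub>R axis 2 1"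
  by (simp add: dirvec_def vec_eq_iff forall_2 axis_def)

lemma continuous_on_dirvec [continuous_intros]:
  fixes f :: "'a::t2_space \<Rightarrow> real"
  shows "continuous_on X f \<Longrightarrow> continuous_on X (\<lambda>x. dirvec (f x))"
  unfolding dirvec_axis by (auto intro!: continuous_intros)

lemma unit_vector_dirvec:
  assumes "norm (\<theta>::pt) = 1"
  obtains \<phi> where "\<theta> = dirvec \<phi>"
proof -
  have "(\<theta> $ 1)\<^sup>2 + (\<theta> $ 2)\<^sup>2 = 1"
    using assms by (simp add: norm_eq_sqrt_inner inner_vec_def sum_2 power2_eq_square)
  then obtain t where "\<theta> $ 1 = cos t" "\<theta> $ 2 = sin t" using sincos_total_2pi by metis
  then have "\<theta> = dirvec t" by (simp add: dirvec_def vec_eq_iff forall_2)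
  then show ?thesis using that by blast
qed

lemma integral_eq_of_support:
  fixes f :: "'a::euclidean_space \<Rightarrow> 'b::banach"
  assumes "\<And>t. t \<in> S \<Longrightarrow> t \<notin> T \<Longrightarrow> f t = 0" "\<And>t. t \<in> T \<Longrightarrow> t \<notin> S \<Longrightarrow> f t = 0"
  shows "integral S f = integral T f"
proof -
  have "(\<lambda>t. if t \<in> S then f t else 0) = (\<lambda>t. if t \<in> T then f t else 0)"
    using assms by (auto simp: fun_eq_iff)
  then show ?thesis by (metis Henstock_Kurzweil_Integration.integral_restrict_UNIV)
qed

lemma norm_add_scaleR_dirvec_ge:
  assumes "\<bar>t\<bar> \<ge> norm x + r"
  shows "norm (x + t *\<^sub>R dirvec \<phi>) \<ge> r"
  using norm_diff_ineq[of "t *\<^sub>R dirvec \<phi>" x] assms by (simp add: add.commute)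

text \<open>The half-line integrals below are integrals over a fixed compact interval only while
  \<open>x\<close> stays in a ball, so their joint continuity is obtained ball by ball.\<close>

lemma continuous_on_UNIV_if_balls:
  fixes f :: "'a::real_normed_vector \<times> 'c::t2_space \<Rightarrow> 'b::topological_space"
  assumes "\<And>r. r > 0 \<Longrightarrow> continuous_on (ball 0 r \<times> UNIV) f"
  shows "continuous_on UNIV f"
proof -
  have "isCont f p" for p
  proof -
    have "p \<in> ball 0 (norm (fst p) + 1) \<times> UNIV" by (cases p) auto
    moreover have "open (ball 0 (norm (fst p) + 1) \<times> (UNIV :: 'c set))" by (intro open_Times) auto
    ultimately show ?thesis
      using assms[of "norm (fst p) + 1"] by (metis add_nonneg_pos continuous_on_eq_continuous_at norm_ge_zero zero_less_one)
  qed
  then show ?thesis by (simp add: continuous_at_imp_continuous_on)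
qed

text \<open>Dirichlet kernels: raising \<open>n\<close> by 2 adds
  \<open>2 * cos ((n + 1) * u)\<close> to the ratio, and this integrates to 0 over
  \<open>{0..pi}\<close>, so only the parity of \<open>n\<close> matters. These integrals become the
  multipliers of \<open>hilb\<close>.\<close>

lemma has_bochner_integral_sin_ratio:
  "has_bochner_integral lborel (\<lambda>u. indicator {0<..<pi} u * (sin (real n * u) / sin u)) (if even n then 0 else pi)"
proof (induction n rule: nat_induct2)
  case 1
  have "has_bochner_integral lborel (indicator {0<..<pi} :: real \<Rightarrow> real) (measure lborel {0<..<pi})"
    by (intro has_bochner_integral_real_indicator) auto
  moreover have "indicator {0<..<pi} u * (sin (real 1 * u) / sin u) = (indicator {0<..<pi} u :: real)" for u
    using sin_gt_zero[of u] by (auto simp: indicator_def)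
  ultimately show ?case by (simp only:) simp
next
  case (step n)
  define m where "m = real n + 1"
  have m: "m > 0" by (simp add: m_def)
  have "has_bochner_integral lborel (\<lambda>u. indicator {0..pi} u *\<^sub>R (2 * cos (m * u))) (2 * sin (m * pi) / m - 2 * sin (m * 0) / m)"
    using m by (intro has_bochner_integral_FTC_Icc)
       (auto intro!: derivative_eq_intros continuous_intros simp: has_real_derivative_iff_has_vector_derivative[symmetric])
  moreover have "sin (m * pi) = 0" unfolding m_def using sin_npi[of "Suc n"] by (simp add: add.commute)
  ultimately have "has_bochner_integral lborel (\<lambda>u. indicator {0..pi} u *\<^sub>R (2 * cos (m * u))) 0" by simp
  moreover have "AE u in lborel. indicator {0..pi} u *\<^sub>R (2 * cos (m * u)) = indicator {0<..<pi} u * (2 * cos (m * u))"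
    using AE_lborel_singleton[of 0] AE_lborel_singleton[of pi] by eventually_elim (auto simp: indicator_def)
  ultimately have "has_bochner_integral lborel (\<lambda>u. indicator {0<..<pi} u * (2 * cos (m * u))) 0"
    by (subst has_bochner_integral_cong_AE[symmetric, where f = "\<lambda>u. indicator {0..pi} u *\<^sub>R (2 * cos (m * u))"]) auto
  from has_bochner_integral_add[OF step this]
  have "has_bochner_integral lborel (\<lambda>u. indicator {0<..<pi} u * (sin (real n * u) / sin u)
      + indicator {0<..<pi} u * (2 * cos (m * u))) (if even n then 0 else pi)" by simp
  moreover have "indicator {0<..<pi} u * (sin (real n * u) / sin u) + indicator {0<..<pi} u * (2 * cos (m * u))
      = indicator {0<..<pi} u * (sin (real (n + 2) * u) / sin u)" for u
  proof (cases "u \<in> {0<..<pi}")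
    case True
    then have "sin u > 0" by (simp add: sin_gt_zero)
    have "sin (m * u + u) - sin (m * u - u) = 2 * cos (m * u) * sin u" by (simp add: sin_add sin_diff)
    moreover have "m * u + u = real (n + 2) * u" "m * u - u = real n * u" by (simp_all add: m_def algebra_simps)
    ultimately have "sin (real n * u) + 2 * cos (m * u) * sin u = sin (real (n + 2) * u)" by simp
    with \<open>sin u > 0\<close> True show ?thesis by (simp add: field_simps)
  qed simp
  ultimately show ?case by simp
qed (simp add: has_bochner_integral_zero)

lemma cot_eq_tan: "cot u = tan (pi / 2 - u)" for u :: real
  by (simp add: cot_def tan_def sin_diff cos_diff)

lemma cot_image: "cot ` {0<..<pi} = (UNIV :: real set)"
proof -
  have "c = cot (pi / 2 - arctan c) \<and> pi / 2 - arctan c \<in> {0<..<pi}" for c :: real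
    using arctan_bounded[of c] by (auto simp: cot_eq_tan tan_arctan)
  then show ?thesis by blast
qed

lemma cot_inj: "inj_on cot {0<..<pi::real}"
proof (rule inj_onI)
  fix x y :: real assume "x \<in> {0<..<pi}" "y \<in> {0<..<pi}" "cot x = cot y"
  then have "arctan (tan (pi / 2 - x)) = arctan (tan (pi / 2 - y))"
    "- (pi / 2) < pi / 2 - x" "pi / 2 - x < pi / 2" "- (pi / 2) < pi / 2 - y" "pi / 2 - y < pi / 2"
    by (auto simp: cot_eq_tan)
  then show "x = y" using arctan_tan[of "pi/2 - x"] arctan_tan[of "pi/2 - y"] by auto
qed

text \<open>Models an attenuation on the whole plane after extension by zero, which may fail to be
  differentiable across the boundary but keeps a Lipschitz bound.\<close>

locale plane_attenuation =
  fixes a :: "pt \<Rightarrow> real" and L R :: real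
  assumes lip: "\<And>x y. \<bar>a x - a y\<bar> \<le> L * dist x y"
    and supp: "\<And>x. norm x \<ge> R \<Longrightarrow> a x = 0"
    and R_pos: "R > 0"
begin

lemma L_nonneg: "L \<ge> 0"
proof -
  have "0 \<le> \<bar>a 0 - a (axis 1 1)\<bar>" by simp
  also have "\<dots> \<le> L" using lip[of 0 "axis 1 1"] by (simp add: dist_norm)
  finally show ?thesis .
qed

lemma continuous_a: "continuous_on X a"
proof -
  have "(L)-lipschitz_on X a" using lip L_nonneg by (intro lipschitz_onI) (auto simp: dist_real_def)
  then show ?thesis by (rule lipschitz_on_continuous_on)
qed

lemma continuous_a_comp [continuous_intros]: "continuous_on X f \<Longrightarrow> continuous_on X (\<lambda>x. a (f x))"
  by (rule continuous_on_compose2[OF continuous_a[of UNIV]]) auto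

lemma measurable_a [measurable]: "a \<in> borel_measurable borel"
  by (intro borel_measurable_continuous_onI continuous_a)

definition beam :: "pt \<Rightarrow> real \<Rightarrow> real" where
  "beam x \<phi> = integral {0..} (\<lambda>t. a (x + t *\<^sub>R dirvec \<phi>))"

lemma beam_eq: "norm x + R \<le> N \<Longrightarrow> beam x \<phi> = integral {0..N} (\<lambda>t. a (x + t *\<^sub>R dirvec \<phi>))"
  unfolding beam_def by (rule integral_eq_of_support) (auto intro!: supp norm_add_scaleR_dirvec_ge)

lemma beam_periodic [simp]: "beam x (\<phi> + 2 * pi) = beam x \<phi>"
  by (simp add: beam_def)

lemma continuous_beam: "continuous_on X (\<lambda>p. beam (fst p) (snd p))"
proof -
  have "continuous_on UNIV (\<lambda>p. beam (fst p) (snd p))"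
  proof (rule continuous_on_UNIV_if_balls)
    fix r :: real assume "r > 0"
    have "continuous_on (ball 0 r \<times> UNIV) (\<lambda>p. integral (cbox 0 (r + R)) (\<lambda>t. a (fst p + t *\<^sub>R dirvec (snd p))))"
      by (rule integral_continuous_on_param) (auto simp: case_prod_unfold intro!: continuous_intros)
    then show "continuous_on (ball 0 r \<times> UNIV) (\<lambda>p. beam (fst p) (snd p))"
      by (rule continuous_on_eq) (auto simp: beam_eq[where N = "r + R"])
  qed
  then show ?thesis using continuous_on_subset by blast
qed

lemma continuous_beam_comp [continuous_intros]:
  "continuous_on X f \<Longrightarrow> continuous_on X g \<Longrightarrow> continuous_on X (\<lambda>p. beam (f p) (g p))"
  by (rule continuous_on_compose2[OF continuous_beam[of UNIV], of X "\<lambda>p. (f p, g p)", simplified])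
     (intro continuous_on_Pair)

lemma measurable_beam [measurable]: "beam x \<in> borel_measurable borel"
  by (intro borel_measurable_continuous_onI continuous_intros)

text \<open>One factor \<open>r + R\<close> bounds how far the rays spread per unit of direction
  gap, the other is the length of integration. The resulting bound compensates the zeros of
  \<open>sin u\<close> in \<open>hilb_kernel\<close>.\<close>

lemma beam_lipschitz:
  assumes "norm x \<le> r"
  shows "\<bar>beam x \<phi> - beam x \<psi>\<bar> \<le> L * (r + R)\<^sup>2 * norm (dirvec \<phi> - dirvec \<psi>)"
proof -
  define N where "N = r + R"
  have N: "N \<ge> 0" "norm x + R \<le> N" using assms R_pos norm_ge_zero[of x] by (auto simp: N_def simp del: norm_ge_zero)
  have int: "(\<lambda>t. a (x + t *\<^sub>R dirvec \<psi>)) integrable_on {0..N}" for \<psi>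
    by (intro integrable_continuous_real continuous_intros)
  have "beam x \<phi> - beam x \<psi> = integral {0..N} (\<lambda>t. a (x + t *\<^sub>R dirvec \<phi>) - a (x + t *\<^sub>R dirvec \<psi>))"
    unfolding beam_eq[OF N(2)] by (rule integral_diff[symmetric, OF int int])
  also have "norm \<dots> \<le> integral {0..N} (\<lambda>t. L * (N * norm (dirvec \<phi> - dirvec \<psi>)))"
  proof (intro integral_norm_bound_integral integrable_diff int integrable_const_ivl)
    fix t assume t: "t \<in> {0..N}"
    have "norm (a (x + t *\<^sub>R dirvec \<phi>) - a (x + t *\<^sub>R dirvec \<psi>)) \<le> L * (t * norm (dirvec \<phi> - dirvec \<psi>))"
      using lip[of "x + t *\<^sub>R dirvec \<phi>" "x + t *\<^sub>R dirvec \<psi>"] t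
      by (simp add: dist_norm flip: scaleR_diff_right)
    also have "\<dots> \<le> L * (N * norm (dirvec \<phi> - dirvec \<psi>))"
      using t by (intro mult_left_mono mult_right_mono L_nonneg) auto
    finally show "norm (a (x + t *\<^sub>R dirvec \<phi>) - a (x + t *\<^sub>R dirvec \<psi>)) \<le> L * (N * norm (dirvec \<phi> - dirvec \<psi>))" .
  qed
  also have "\<dots> = L * N\<^sup>2 * norm (dirvec \<phi> - dirvec \<psi>)" using N by (simp add: power2_eq_square)
  finally show ?thesis by (simp add: N_def)
qed

text \<open>The principal value of the convolution with \<open>1 / sin\<close>: pairing the angles \<open>\<phi> + u\<close> and \<open>\<phi> - u\<close>
  leaves a bounded integrand.\<close>

definition hilb_kernel :: "pt \<Rightarrow> real \<Rightarrow> real \<Rightarrow> real" where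
  "hilb_kernel x \<phi> u = indicator {0<..<pi} u * ((beam x (\<phi> + u) - beam x (\<phi> - u)) / sin u)"

definition hilb :: "pt \<Rightarrow> real \<Rightarrow> real" where
  "hilb x \<phi> = (\<integral>u. hilb_kernel x \<phi> u \<partial>lborel) / (2 * pi)"

lemma hilb_kernel_bound:
  assumes "norm x \<le> r"
  shows "\<bar>hilb_kernel x \<phi> u\<bar> \<le> indicator {0<..<pi} u * (2 * L * (r + R)\<^sup>2)"
proof (cases "u \<in> {0<..<pi}")
  case True
  then have s: "sin u > 0" by (simp add: sin_gt_zero)
  have "\<bar>beam x (\<phi> + u) - beam x (\<phi> - u)\<bar> \<le> L * (r + R)\<^sup>2 * (2 * sin u)"
    using beam_lipschitz[OF assms, of "\<phi> + u" "\<phi> - u"] s unfolding norm_dirvec_add_diff by simp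
  then show ?thesis using True s by (simp add: hilb_kernel_def field_simps)
qed (simp add: hilb_kernel_def)

lemma hilb_kernel_measurable [measurable]: "hilb_kernel x \<phi> \<in> borel_measurable borel"
  unfolding hilb_kernel_def by measurable

lemma hilb_bound_integrable: "integrable lborel (\<lambda>u. indicator {0<..<pi} u * (c::real))"
  by (intro integrable_mult_left integrable_real_indicator) auto

lemma hilb_kernel_integrable: "integrable lborel (hilb_kernel x \<phi>)"
  by (rule Bochner_Integration.integrable_bound[OF hilb_bound_integrable[of "2 * L * (norm x + R)\<^sup>2"]])
     (use hilb_kernel_bound[OF order_refl] L_nonneg in \<open>auto simp: abs_mult\<close>)

lemma hilb_periodic [simp]: "hilb x (\<phi> + 2 * pi) = hilb x \<phi>"
proof -
  have "beam x (\<phi> + 2 * pi + u) = beam x (\<phi> + u)" "beam x (\<phi> + 2 * pi - u) = beam x (\<phi> - u)" for u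
    using beam_periodic[of x "\<phi> + u"] beam_periodic[of x "\<phi> - u"] by (simp_all add: algebra_simps)
  then show ?thesis by (simp add: hilb_def hilb_kernel_def)
qed

text \<open>Dominated convergence: a convergent sequence of base points is bounded, so a single
  radius \<open>r\<close> bounds all the kernels.\<close>

lemma continuous_hilb: "continuous_on X (\<lambda>p. hilb (fst p) (snd p))"
proof -
  have "isCont (\<lambda>p. hilb (fst p) (snd p)) p" for p
  proof (rule continuous_at_sequentiallyI)
    fix q assume q: "q \<longlonglongrightarrow> p"
    then have f: "(\<lambda>n. fst (q n)) \<longlonglongrightarrow> fst p" and s: "(\<lambda>n. snd (q n)) \<longlonglongrightarrow> snd p"
      by (auto intro: tendsto_fst tendsto_snd)
    from f have "bounded (range (\<lambda>n. fst (q n)))" by (rule convergent_imp_bounded)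
    then obtain r where r: "\<And>n. norm (fst (q n)) \<le> r" by (auto simp: bounded_iff)
    have "(\<lambda>n. \<integral>u. hilb_kernel (fst (q n)) (snd (q n)) u \<partial>lborel) \<longlonglongrightarrow> (\<integral>u. hilb_kernel (fst p) (snd p) u \<partial>lborel)"
    proof (rule integral_dominated_convergence[where w = "\<lambda>u. indicator {0<..<pi} u * (2 * L * (r + R)\<^sup>2)"])
      show "AE u in lborel. (\<lambda>n. hilb_kernel (fst (q n)) (snd (q n)) u) \<longlonglongrightarrow> hilb_kernel (fst p) (snd p) u"
      proof (rule AE_I2)
        fix u
        have "continuous_on UNIV (\<lambda>p. hilb_kernel (fst p) (snd p) u)"
          unfolding hilb_kernel_def divide_inverse by (intro continuous_intros)
        then have *: "isCont (\<lambda>p. hilb_kernel (fst p) (snd p) u) p"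
          by (cases p) (simp add: continuous_on_eq_continuous_at)
        show "(\<lambda>n. hilb_kernel (fst (q n)) (snd (q n)) u) \<longlonglongrightarrow> hilb_kernel (fst p) (snd p) u"
          using isCont_tendsto_compose[OF * q] .
      qed
      show "AE u in lborel. norm (hilb_kernel (fst (q n)) (snd (q n)) u) \<le> indicator {0<..<pi} u * (2 * L * (r + R)\<^sup>2)" for n
        using hilb_kernel_bound[OF r] by simp
    qed (use hilb_bound_integrable in auto)
    then show "(\<lambda>n. hilb (fst (q n)) (snd (q n))) \<longlonglongrightarrow> hilb (fst p) (snd p)"
      unfolding hilb_def by (intro tendsto_intros) auto
  qed
  then show ?thesis by (simp add: continuous_at_imp_continuous_on)
qed

lemma continuous_hilb_comp [continuous_intros]:
  "continuous_on X f \<Longrightarrow> continuous_on X g \<Longrightarrow> continuous_on X (\<lambda>p. hilb (f p) (g p))"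
  by (rule continuous_on_compose2[OF continuous_hilb[of UNIV], of X "\<lambda>p. (f p, g p)", simplified])
     (intro continuous_on_Pair)

text \<open>Fubini reduces this to the modes of \<open>b (\<phi> + u) - b (\<phi> - u)\<close>,
  which carry the factor \<open>2 * \<i> * sin (k * u)\<close>. Divided by \<open>sin u\<close> it
  becomes a Dirichlet kernel with integral 0 or \<open>pi\<close>, and the
  \<open>1 / (2 * pi)\<close> in \<open>hilb\<close> is chosen to leave exactly
  \<open>- \<i>\<close> on odd negative modes.\<close>

lemma fcoeff_hilb:
  assumes "k < 0"
  shows "fcoeff (\<lambda>\<phi>. complex_of_real (hilb x \<phi>)) k
    = (if even k then 0 else - \<i> * fcoeff (\<lambda>\<phi>. complex_of_real (beam x \<phi>)) k)"
proof -
  define b where "b = (\<lambda>\<phi>. complex_of_real (beam x \<phi>))"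
  have cb: "continuous_on UNIV b" and pb: "b (\<phi> + 2 * pi) = b \<phi>" for \<phi>
    unfolding b_def by (auto intro!: continuous_intros)
  have cb': "continuous_on UNIV (\<lambda>\<phi>. b (\<phi> + u))" "continuous_on UNIV (\<lambda>\<phi>. b (\<phi> - u))" for u
    unfolding b_def by (auto intro!: continuous_intros)
  define g where "g = (\<lambda>\<phi> u. indicator {0..2*pi} \<phi> *\<^sub>R (complex_of_real (hilb_kernel x \<phi> u) * cis (- (of_int k * \<phi>))))"
  have meas: "(\<lambda>p. hilb_kernel x (fst p) (snd p)) \<in> borel_measurable (lborel \<Otimes>\<^sub>M lborel)"
    unfolding hilb_kernel_def by measurable
  have intg: "integrable (lborel \<Otimes>\<^sub>M lborel) (case_prod g)"
  proof (rule Bochner_Integration.integrable_bound)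
    show "integrable (lborel \<Otimes>\<^sub>M lborel) (\<lambda>p. indicator ({0..2*pi} \<times> {0<..<pi}) p * (2 * L * (norm x + R)\<^sup>2))"
      unfolding lborel_prod
      by (intro integrable_mult_left integrable_real_indicator emeasure_bounded_finite)
         (auto simp: bounded_Times intro!: borel_Times)
    have "(\<lambda>p::real\<times>real. cis (- (of_int k * fst p))) \<in> borel_measurable borel"
      by (intro borel_measurable_continuous_onI continuous_intros)
    then have [measurable]: "(\<lambda>p::real\<times>real. cis (- (of_int k * fst p))) \<in> borel_measurable (lborel \<Otimes>\<^sub>M lborel)"
      by (simp add: lborel_prod)
    show "case_prod g \<in> borel_measurable (lborel \<Otimes>\<^sub>M lborel)"
      using meas unfolding g_def case_prod_unfold by measurable
    show "AE p in lborel \<Otimes>\<^sub>M lborel. norm (case_prod g p) \<le> norm (indicator ({0..2*pi} \<times> {0<..<pi}) p * (2 * L * (norm x + R)\<^sup>2))"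
    proof (rule AE_I2)
      fix p :: "real \<times> real"
      show "norm (case_prod g p) \<le> norm (indicator ({0..2*pi} \<times> {0<..<pi}) p * (2 * L * (norm x + R)\<^sup>2))"
        using hilb_kernel_bound[OF order_refl, of x "fst p" "snd p"] L_nonneg
        by (cases p) (auto simp: g_def norm_mult indicator_def split: if_splits)
    qed
  qed
  have "fcoeff (\<lambda>\<phi>. complex_of_real (hilb x \<phi>)) k
      = (\<integral>\<phi>. indicator {0..2*pi} \<phi> *\<^sub>R (complex_of_real (hilb x \<phi>) * cis (- (of_int k * \<phi>))) \<partial>lborel)"
    unfolding fcoeff_def
    by (subst set_borel_integral_eq_integral(2)[symmetric])
       (auto simp: set_lebesgue_integral_def intro!: borel_integrable_atLeastAtMost' continuous_intros)
  also have "\<dots> = (\<integral>\<phi>. (\<integral>u. g \<phi> u \<partial>lborel) / (2 * pi) \<partial>lborel)"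
  proof (rule Bochner_Integration.integral_cong[OF refl])
    fix \<phi>
    have "(\<integral>u. g \<phi> u \<partial>lborel) = indicator {0..2*pi} \<phi> *\<^sub>R ((\<integral>u. complex_of_real (hilb_kernel x \<phi> u) \<partial>lborel) * cis (- (of_int k * \<phi>)))"
      unfolding g_def by (simp only: integral_scaleR_right integral_mult_left_zero)
    then show "indicator {0..2*pi} \<phi> *\<^sub>R (complex_of_real (hilb x \<phi>) * cis (- (of_int k * \<phi>))) = (\<integral>u. g \<phi> u \<partial>lborel) / (2 * pi)"
      by (simp add: hilb_def scaleR_conv_of_real)
  qed
  also have "\<dots> = (\<integral>\<phi>. (\<integral>u. g \<phi> u \<partial>lborel) \<partial>lborel) / (2 * pi)" by simp
  also have "(\<integral>\<phi>. (\<integral>u. g \<phi> u \<partial>lborel) \<partial>lborel) = (\<integral>u. (\<integral>\<phi>. g \<phi> u \<partial>lborel) \<partial>lborel)"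
    by (rule lborel_pair.Fubini_integral[OF intg, symmetric])
  also have "(\<lambda>u. \<integral>\<phi>. g \<phi> u \<partial>lborel)
     = (\<lambda>u. complex_of_real (indicator {0<..<pi} u * (sin (real (nat (- k)) * u) / sin u)) * (- 2 * \<i> * fcoeff b k))"
  proof
    fix u
    have "(\<integral>\<phi>. g \<phi> u \<partial>lborel) = (\<integral>\<phi>. complex_of_real (indicator {0<..<pi} u / sin u) *
        (indicator {0..2*pi} \<phi> *\<^sub>R ((b (\<phi> + u) - b (\<phi> - u)) * cis (- (of_int k * \<phi>)))) \<partial>lborel)"
      by (rule Bochner_Integration.integral_cong[OF refl])
         (simp add: g_def hilb_kernel_def b_def scaleR_conv_of_real)
    also have "\<dots> = complex_of_real (indicator {0<..<pi} u / sin u) *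
       (\<integral>\<phi>. indicator {0..2*pi} \<phi> *\<^sub>R ((b (\<phi> + u) - b (\<phi> - u)) * cis (- (of_int k * \<phi>))) \<partial>lborel)"
      by (rule integral_mult_right_zero)
    also have "(\<integral>\<phi>. indicator {0..2*pi} \<phi> *\<^sub>R ((b (\<phi> + u) - b (\<phi> - u)) * cis (- (of_int k * \<phi>))) \<partial>lborel)
       = fcoeff (\<lambda>\<phi>. b (\<phi> + u) - b (\<phi> - u)) k"
      unfolding fcoeff_def
      by (subst set_borel_integral_eq_integral(2)[symmetric])
         (auto simp: b_def set_lebesgue_integral_def intro!: borel_integrable_atLeastAtMost' continuous_intros)
    also have "\<dots> = fcoeff (\<lambda>\<phi>. b (\<phi> + u)) k - fcoeff (\<lambda>\<phi>. b (\<phi> - u)) k"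
      by (rule fcoeff_diff[OF cb'])
    also have "\<dots> = (cis (of_int k * u) - cis (of_int k * (- u))) * fcoeff b k"
      using fcoeff_shift[OF cb pb, of u k] fcoeff_shift[OF cb pb, of "- u" k] by (simp add: left_diff_distrib)
    also have "cis (of_int k * u) - cis (of_int k * (- u)) = - 2 * \<i> * complex_of_real (sin (real (nat (- k)) * u))"
      using assms by (simp add: complex_eq_iff)
    finally show "(\<integral>\<phi>. g \<phi> u \<partial>lborel)
      = complex_of_real (indicator {0<..<pi} u * (sin (real (nat (- k)) * u) / sin u)) * (- 2 * \<i> * fcoeff b k)"
      by simp
  qed
  also have "(\<integral>u. complex_of_real (indicator {0<..<pi} u * (sin (real (nat (- k)) * u) / sin u)) * (- 2 * \<i> * fcoeff b k) \<partial>lborel)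
      = complex_of_real (if even (nat (- k)) then 0 else pi) * (- 2 * \<i> * fcoeff b k)"
    using has_bochner_integral_integral_eq[OF has_bochner_integral_sin_ratio[of "nat (- k)"]]
    by (simp only: integral_mult_left_zero integral_complex_of_real)
  finally show ?thesis using assms by (auto simp: b_def even_nat_iff)
qed

section \<open>Invariance of the Hilbert transform along lines\<close>

lemma beam_lebesgue:
  "has_bochner_integral lborel (\<lambda>t. indicator {0<..} t * a (x + t *\<^sub>R dirvec \<phi>)) (beam x \<phi>)"
proof -
  define N where "N = norm x + R"
  have N: "N > 0" using R_pos by (simp add: N_def add_nonneg_pos)
  have si: "set_integrable lborel {0..N} (\<lambda>t. a (x + t *\<^sub>R dirvec \<phi>))"
    by (intro borel_integrable_atLeastAtMost' continuous_intros)
  then have "has_bochner_integral lborel (\<lambda>t. indicator {0..N} t *\<^sub>R a (x + t *\<^sub>R dirvec \<phi>)) (beam x \<phi>)"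
    using set_borel_integral_eq_integral(2)[OF si] beam_eq[of x N \<phi>]
    unfolding set_integrable_def set_lebesgue_integral_def has_bochner_integral_iff by (simp add: N_def)
  moreover have "AE t in lborel. indicator {0..N} t *\<^sub>R a (x + t *\<^sub>R dirvec \<phi>) = indicator {0<..} t * a (x + t *\<^sub>R dirvec \<phi>)"
    using AE_lborel_singleton[of 0]
  proof eventually_elim
    case (elim t)
    have "a (x + t *\<^sub>R dirvec \<phi>) = 0" if "t > N"
      using that by (intro supp norm_add_scaleR_dirvec_ge) (auto simp: N_def)
    then show ?case using elim by (auto simp: indicator_def)
  qed
  ultimately show ?thesis
    by (subst has_bochner_integral_cong_AE[symmetric, where f = "\<lambda>t. indicator {0..N} t *\<^sub>R a (x + t *\<^sub>R dirvec \<phi>)"]) auto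
qed

text \<open>The two points are mirror images in the line through \<open>x\<close> with direction
  \<open>dirvec \<phi>\<close>: \<open>s\<close> is their distance to that line and
  \<open>s * c\<close> the position of their common foot relative to \<open>x\<close>.\<close>

definition fan :: "pt \<Rightarrow> real \<Rightarrow> real \<Rightarrow> real \<Rightarrow> real" where
  "fan x \<phi> s c = indicator {0<..} s *
     (a (x + s *\<^sub>R (c *\<^sub>R dirvec \<phi> + dirvec (\<phi> + pi / 2))) - a (x + s *\<^sub>R (c *\<^sub>R dirvec \<phi> - dirvec (\<phi> + pi / 2))))"

text \<open>A foot at \<open>s * c\<close> from the moved base point lies at
  \<open>\<tau> + s * c\<close> from the old one. Division by \<open>s\<close> makes this a pure
  translation of \<open>c\<close>, which an integral over all \<open>c\<close> does not
  notice.\<close>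

lemma fan_translate:
  assumes "s > 0"
  shows "fan (x + \<tau> *\<^sub>R dirvec \<phi>) \<phi> s c = fan x \<phi> s (\<tau> / s + c)"
proof -
  have "x + \<tau> *\<^sub>R dirvec \<phi> + s *\<^sub>R (c *\<^sub>R dirvec \<phi> + w) = x + s *\<^sub>R ((\<tau> / s + c) *\<^sub>R dirvec \<phi> + w)" for w
    using assms by (simp add: scaleR_add_right scaleR_add_left)
  from this[of "dirvec (\<phi> + pi / 2)"] this[of "- dirvec (\<phi> + pi / 2)"]
  show ?thesis unfolding fan_def by (simp only: diff_conv_add_uminus)
qed

lemma integral_fan_translate:
  "(\<integral>c. fan (x + \<tau> *\<^sub>R dirvec \<phi>) \<phi> s c \<partial>lborel) = (\<integral>c. fan x \<phi> s c \<partial>lborel)"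
proof (cases "s > 0")
  case True
  have "(\<integral>c. fan x \<phi> s c \<partial>lborel) = \<bar>1\<bar> *\<^sub>R (\<integral>c. fan x \<phi> s (\<tau> / s + 1 * c) \<partial>lborel)"
    by (rule lborel_integral_real_affine) simp
  then show ?thesis using True by (simp add: fan_translate)
qed (simp add: fan_def)

text \<open>The mirror points are \<open>2 * s\<close> apart, so the Lipschitz bound supplies a
  factor \<open>s\<close>. It cancels the length \<open>2 * N / s\<close> of the range of
  \<open>c\<close>, which makes \<open>fan\<close> integrable near \<open>s = 0\<close>.\<close>

lemma fan_bound:
  assumes "N = norm x + R"
  shows "\<bar>fan x \<phi> s c\<bar> \<le> indicator {0<..<N} s * (indicator {- (N / s)..N / s} c * (2 * L * s))"
proof (cases "0 < s \<and> s < N \<and> s * \<bar>c\<bar> \<le> N")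
  case True
  let ?w = "dirvec (\<phi> + pi / 2)"
  have "\<bar>fan x \<phi> s c\<bar> \<le> L * dist (x + s *\<^sub>R (c *\<^sub>R dirvec \<phi> + ?w)) (x + s *\<^sub>R (c *\<^sub>R dirvec \<phi> - ?w))"
    using True lip[of "x + s *\<^sub>R (c *\<^sub>R dirvec \<phi> + ?w)" "x + s *\<^sub>R (c *\<^sub>R dirvec \<phi> - ?w)"]
    by (simp add: fan_def)
  also have "dist (x + s *\<^sub>R (c *\<^sub>R dirvec \<phi> + ?w)) (x + s *\<^sub>R (c *\<^sub>R dirvec \<phi> - ?w)) = norm ((2 * s) *\<^sub>R ?w)"
    unfolding dist_norm by (rule arg_cong[where f = norm]) (simp add: vec_eq_iff algebra_simps)
  also have "\<dots> = 2 * s" using True by simp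
  finally have "\<bar>fan x \<phi> s c\<bar> \<le> 2 * L * s" by simp
  moreover have "\<bar>c\<bar> \<le> N / s" using True by (simp add: field_simps)
  ultimately show ?thesis using True by (auto simp: indicator_def abs_le_iff)
next
  case False
  have L0: "0 \<le> indicator {0<..<N} s * (indicator {- (N / s)..N / s} c * (2 * L * s))"
    using L_nonneg by (auto simp: indicator_def)
  have "fan x \<phi> s c = 0"
  proof (cases "s > 0")
    case True
    \<comment> \<open>The two components are orthogonal, so either point has distance
      \<open>s * sqrt (c^2 + 1)\<close> from \<open>x\<close>. This is at least \<open>s\<close> and
      at least \<open>s * \<bar>c\<bar>\<close>, one of which reaches \<open>N\<close> in the
      present case.\<close>
    have "(norm (c *\<^sub>R dirvec \<phi> + e *\<^sub>R dirvec (\<phi> + pi / 2)))\<^sup>2 = c\<^sup>2 + e\<^sup>2" for e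
      unfolding power2_norm_eq_inner
      by (simp add: inner_add_left inner_add_right inner_dirvec_perp inner_commute[of "dirvec (\<phi> + pi / 2)"]
           power2_eq_square)
    then have n: "norm (c *\<^sub>R dirvec \<phi> + e *\<^sub>R dirvec (\<phi> + pi / 2)) = sqrt (c\<^sup>2 + e\<^sup>2)" for e
      by (metis norm_ge_zero real_sqrt_abs abs_of_nonneg)
    have z: "a (x + s *\<^sub>R (c *\<^sub>R dirvec \<phi> + e *\<^sub>R dirvec (\<phi> + pi / 2))) = 0" if "e\<^sup>2 = 1" for e
    proof (rule supp)
      have "1 \<le> sqrt (c\<^sup>2 + e\<^sup>2)" "\<bar>c\<bar> \<le> sqrt (c\<^sup>2 + e\<^sup>2)"
        using that by (auto intro!: real_le_rsqrt)
      from this[THEN mult_left_mono, OF less_imp_le[OF True]]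
      have "N \<le> s * sqrt (c\<^sup>2 + e\<^sup>2)" using False True by linarith
      also have "\<dots> = norm (s *\<^sub>R (c *\<^sub>R dirvec \<phi> + e *\<^sub>R dirvec (\<phi> + pi / 2)))" using True by (simp add: n)
      finally show "R \<le> norm (x + s *\<^sub>R (c *\<^sub>R dirvec \<phi> + e *\<^sub>R dirvec (\<phi> + pi / 2)))"
        using norm_diff_ineq[of "s *\<^sub>R (c *\<^sub>R dirvec \<phi> + e *\<^sub>R dirvec (\<phi> + pi / 2))" x] assms
        by (simp add: add.commute)
    qed
    from z[of 1] z[of "-1"] show ?thesis by (simp add: fan_def)
  qed (simp add: fan_def)
  then show ?thesis using L0 by simp
qed

lemma measurable_fan [measurable]: "(\<lambda>p. fan x \<phi> (fst p) (snd p)) \<in> borel_measurable (borel \<Otimes>\<^sub>M borel)"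
  unfolding fan_def by measurable

lemma measurable_fan_snd [measurable]: "fan x \<phi> s \<in> borel_measurable borel"
  unfolding fan_def by measurable

lemma fan_integrable: "integrable (lborel \<Otimes>\<^sub>M lborel) (\<lambda>(s, c). fan x \<phi> s c)"
proof (rule lborel_pair.Fubini_integrable)
  define N where "N = norm x + R"
  have N: "N > 0" using R_pos by (simp add: N_def add_nonneg_pos)
  note bd = fan_bound[OF N_def]
  have I: "integrable lborel (\<lambda>c. indicator {0<..<N} s * (indicator {- (N / s)..N / s} c * (2 * L * s)))" for s
    by (intro integrable_mult_right integrable_mult_left integrable_real_indicator emeasure_bounded_finite) auto
  have J: "integrable lborel (\<lambda>c. fan x \<phi> s c)" for s
    by (rule Bochner_Integration.integrable_bound[OF I[of s]])
       (use bd L_nonneg in \<open>auto intro: order_trans[OF bd abs_ge_self]\<close>)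
  show "(\<lambda>(s, c). fan x \<phi> s c) \<in> borel_measurable (lborel \<Otimes>\<^sub>M lborel)"
    using measurable_fan by (simp add: case_prod_unfold)
  show "AE s in lborel. integrable lborel (\<lambda>c. case (s, c) of (s, c) \<Rightarrow> fan x \<phi> s c)" using J by simp
  show "integrable lborel (\<lambda>s. \<integral>c. norm (case (s, c) of (s, c) \<Rightarrow> fan x \<phi> s c) \<partial>lborel)"
  proof (rule Bochner_Integration.integrable_bound)
    show "integrable lborel (\<lambda>s. indicator {0<..<N} s * (4 * L * N))"
      by (intro integrable_mult_left integrable_real_indicator emeasure_bounded_finite) auto
    show "(\<lambda>s. \<integral>c. norm (case (s, c) of (s, c) \<Rightarrow> fan x \<phi> s c) \<partial>lborel) \<in> borel_measurable lborel"
      by measurable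
    show "AE s in lborel. norm (\<integral>c. norm (case (s, c) of (s, c) \<Rightarrow> fan x \<phi> s c) \<partial>lborel) \<le> norm (indicator {0<..<N} s * (4 * L * N))"
    proof (rule AE_I2)
      fix s
      have "(\<integral>c. norm (fan x \<phi> s c) \<partial>lborel) \<le> (\<integral>c. indicator {0<..<N} s * (indicator {- (N / s)..N / s} c * (2 * L * s)) \<partial>lborel)"
        using bd J[of s] I[of s] by (intro integral_mono) auto
      also have "\<dots> = indicator {0<..<N} s * (measure lborel {- (N / s)..N / s} * (2 * L * s))" by simp
      also have "\<dots> = indicator {0<..<N} s * (4 * L * N)"
        using N by (cases "s \<in> {0<..<N}") (auto simp: field_simps)
      finally show "norm (\<integral>c. norm (case (s, c) of (s, c) \<Rightarrow> fan x \<phi> s c) \<partial>lborel) \<le> norm (indicator {0<..<N} s * (4 * L * N))"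
        using L_nonneg N by (simp add: abs_mult)
    qed
  qed
qed

text \<open>With \<open>s = t * sin u\<close> and \<open>c = cot u\<close> the mirror points run
  along the rays at angles \<open>\<phi> + u\<close> and \<open>\<phi> - u\<close>; the factor
  \<open>sin u\<close> is the Jacobian.\<close>

lemma integral_fan_cot:
  assumes "u \<in> {0<..<pi}"
  shows "(\<integral>s. fan x \<phi> s (cot u) \<partial>lborel) = sin u * (beam x (\<phi> + u) - beam x (\<phi> - u))"
proof -
  have s: "sin u > 0" using assms by (simp add: sin_gt_zero)
  have "(\<integral>s. fan x \<phi> s (cot u) \<partial>lborel) = \<bar>sin u\<bar> *\<^sub>R (\<integral>t. fan x \<phi> (0 + sin u * t) (cot u) \<partial>lborel)"
    using s by (intro lborel_integral_real_affine) simp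
  also have "(\<lambda>t. fan x \<phi> (0 + sin u * t) (cot u))
     = (\<lambda>t. indicator {0<..} t * a (x + t *\<^sub>R dirvec (\<phi> + u)) - indicator {0<..} t * a (x + t *\<^sub>R dirvec (\<phi> - u)))"
  proof
    fix t
    have "(sin u * t) *\<^sub>R (cot u *\<^sub>R dirvec \<phi> + w) = t *\<^sub>R (cos u *\<^sub>R dirvec \<phi> + sin u *\<^sub>R w)" for w
      using s by (simp add: cot_def scaleR_add_right mult.commute)
    from this[of "dirvec (\<phi> + pi / 2)"] this[of "- dirvec (\<phi> + pi / 2)"]
    show "fan x \<phi> (0 + sin u * t) (cot u) = indicator {0<..} t * a (x + t *\<^sub>R dirvec (\<phi> + u)) - indicator {0<..} t * a (x + t *\<^sub>R dirvec (\<phi> - u))"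
      using s by (simp add: fan_def dirvec_add[of \<phi> u] dirvec_diff indicator_def zero_less_mult_iff)
  qed
  also have "(\<integral>t. (indicator {0<..} t * a (x + t *\<^sub>R dirvec (\<phi> + u)) - indicator {0<..} t * a (x + t *\<^sub>R dirvec (\<phi> - u))) \<partial>lborel)
      = beam x (\<phi> + u) - beam x (\<phi> - u)"
    by (intro has_bochner_integral_integral_eq has_bochner_integral_diff beam_lebesgue)
  finally show ?thesis using s by simp
qed

text \<open>Polar coordinates around \<open>x\<close>, with the angle \<open>u\<close> replaced by its cotangent \<open>c\<close> and the
  radius by the distance \<open>s\<close> to the line through \<open>x\<close>: moving \<open>x\<close> along the line only shifts \<open>c\<close>.\<close>

lemma hilb_eq_fan: "2 * pi * hilb x \<phi> = (\<integral>s. (\<integral>c. fan x \<phi> s c \<partial>lborel) \<partial>lborel)"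
proof -
  define H where "H = (\<lambda>c. \<integral>s. fan x \<phi> s c \<partial>lborel)"
  have intH: "integrable lborel H"
    unfolding H_def using lborel_pair.integrable_snd[OF fan_integrable] .
  have "(\<integral>s. (\<integral>c. fan x \<phi> s c \<partial>lborel) \<partial>lborel) = (\<integral>c. H c \<partial>lborel)"
    unfolding H_def using lborel_pair.Fubini_integral[OF fan_integrable] by simp
  also have "\<dots> = integral (cot ` {0<..<pi}) H" by (simp add: cot_image integral_lborel intH)
  also have "\<dots> = integral {0<..<pi} (\<lambda>u. \<bar>- inverse ((sin u)\<^sup>2)\<bar> *\<^sub>R H (cot u))"
  proof -
    have "H absolutely_integrable_on cot ` {0<..<pi}"
      using intH by (simp add: cot_image set_integrable_def integrable_completion)
    moreover have "(cot has_field_derivative - inverse ((sin u)\<^sup>2)) (at u within {0<..<pi})" if "u \<in> {0<..<pi}" for u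
      using that sin_gt_zero[of u] by (intro DERIV_subset[OF DERIV_cot]) auto
    ultimately show ?thesis
      using has_absolute_integral_change_of_variables_real[of "{0<..<pi}" cot "\<lambda>u. - inverse ((sin u)\<^sup>2)" H
         "integral (cot ` {0<..<pi}) H"] cot_inj by simp
  qed
  \<comment> \<open>The substitution contributes the inverse square of \<open>sin u\<close>; the
    Jacobian in \<open>integral_fan_cot\<close> removes one power and leaves the kernel.\<close>
  also have "\<dots> = integral {0<..<pi} (hilb_kernel x \<phi>)"
  proof (rule Henstock_Kurzweil_Integration.integral_cong)
    fix u assume u: "u \<in> {0<..<pi}"
    then have "sin u > 0" by (simp add: sin_gt_zero)
    with u show "\<bar>- inverse ((sin u)\<^sup>2)\<bar> *\<^sub>R H (cot u) = hilb_kernel x \<phi> u"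
      unfolding H_def integral_fan_cot[OF u] by (simp add: hilb_kernel_def power2_eq_square field_simps)
  qed
  also have "\<dots> = integral UNIV (hilb_kernel x \<phi>)"
    by (rule integral_eq_of_support) (auto simp: hilb_kernel_def)
  also have "\<dots> = 2 * pi * hilb x \<phi>" by (simp add: integral_lborel hilb_kernel_integrable hilb_def)
  finally show ?thesis by simp
qed

lemma hilb_translate: "hilb (x + \<tau> *\<^sub>R dirvec \<phi>) \<phi> = hilb x \<phi>"
proof -
  have "2 * pi * hilb (x + \<tau> *\<^sub>R dirvec \<phi>) \<phi> = 2 * pi * hilb x \<phi>"
    unfolding hilb_eq_fan by (simp only: integral_fan_translate)
  then show ?thesis by simp
qed

end

section \<open>The transport equation\<close>

text \<open>The common data \<open>g\<close> is eliminated by subtracting the two identities; what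
  is left is \<open>ray_zero\<close>, stated on full lines for functions extended by zero.\<close>

locale attenuated_pair = plane_attenuation a L R for a L R +
  fixes f :: "pt \<Rightarrow> real" and F :: "pt \<Rightarrow> pt"
  assumes cont_f: "continuous_on UNIV f" and cont_F: "continuous_on UNIV F"
    and supp_f: "\<And>x. norm x \<ge> R \<Longrightarrow> f x = 0" and supp_F: "\<And>x. norm x \<ge> R \<Longrightarrow> F x = 0"
    and ray_zero: "\<And>x \<phi>. integral UNIV (\<lambda>t. (dirvec \<phi> \<bullet> F (x + t *\<^sub>R dirvec \<phi>) - f (x + t *\<^sub>R dirvec \<phi>)) *
        exp (- beam (x + t *\<^sub>R dirvec \<phi>) \<phi>)) = 0"
begin

lemma continuous_f_comp [continuous_intros]: "continuous_on X g \<Longrightarrow> continuous_on X (\<lambda>x. f (g x))"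
  by (rule continuous_on_compose2[OF cont_f]) auto

lemma continuous_F_comp [continuous_intros]: "continuous_on X g \<Longrightarrow> continuous_on X (\<lambda>x. F (g x))"
  by (rule continuous_on_compose2[OF cont_F]) auto

text \<open>Along a ray \<open>beam\<close> decreases at rate \<open>a\<close>, so
  \<open>exp (- beam)\<close> is an integrating factor of \<open>X + a\<close>: \<open>src\<close>
  is the derivative of \<open>exp (- beam) * v\<close>, and \<open>prim\<close> below recovers that
  product.\<close>

definition src :: "pt \<Rightarrow> real \<Rightarrow> real" where
  "src x \<phi> = (dirvec \<phi> \<bullet> F x - f x) * exp (- beam x \<phi>)"

definition prim :: "pt \<Rightarrow> real \<Rightarrow> real" where
  "prim x \<phi> = integral {..0} (\<lambda>t. src (x + t *\<^sub>R dirvec \<phi>) \<phi>)"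

lemma continuous_src [continuous_intros]:
  fixes g :: "'b::t2_space \<Rightarrow> pt"
  shows "continuous_on X g \<Longrightarrow> continuous_on X h \<Longrightarrow> continuous_on X (\<lambda>p. src (g p) (h p))"
  unfolding src_def by (intro continuous_intros)

lemma src_supp: "norm x \<ge> R \<Longrightarrow> src x \<phi> = 0"
  by (simp add: src_def supp_f supp_F)

lemma src_ray_supp: "\<bar>t\<bar> \<ge> norm x + R \<Longrightarrow> src (x + t *\<^sub>R dirvec \<phi>) \<phi> = 0"
  by (intro src_supp norm_add_scaleR_dirvec_ge)

lemma src_periodic [simp]: "src x (\<phi> + 2 * pi) = src x \<phi>"
  by (simp add: src_def)

lemma prim_periodic [simp]: "prim x (\<phi> + 2 * pi) = prim x \<phi>"
  by (simp add: prim_def)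

lemma prim_eq: "norm x + R \<le> N \<Longrightarrow> prim x \<phi> = integral {-N..0} (\<lambda>t. src (x + t *\<^sub>R dirvec \<phi>) \<phi>)"
  unfolding prim_def by (rule integral_eq_of_support) (auto intro!: src_ray_supp)

lemma prim_line:
  assumes "norm x + R \<le> M" "- M \<le> \<tau>"
  shows "prim (x + \<tau> *\<^sub>R dirvec \<phi>) \<phi> = integral {-M..\<tau>} (\<lambda>s. src (x + s *\<^sub>R dirvec \<phi>) \<phi>)"
proof -
  have "prim (x + \<tau> *\<^sub>R dirvec \<phi>) \<phi> = integral {..0} (\<lambda>t. src (x + (t + \<tau>) *\<^sub>R dirvec \<phi>) \<phi>)"
    unfolding prim_def by (simp add: algebra_simps)
  also have "\<dots> = integral {- M - \<tau>..\<tau> - \<tau>} (\<lambda>t. src (x + (t + \<tau>) *\<^sub>R dirvec \<phi>) \<phi>)"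
    using assms by (intro integral_eq_of_support src_ray_supp) auto
  also have "\<dots> = integral {-M..\<tau>} (\<lambda>s. src (x + s *\<^sub>R dirvec \<phi>) \<phi>)"
    by (rule integral_shift_real_ivl)
  finally show ?thesis .
qed

lemma continuous_prim_pair: "continuous_on UNIV (\<lambda>p. prim (fst p) (snd p))"
proof (rule continuous_on_UNIV_if_balls)
  fix r :: real assume "r > 0"
  have "continuous_on (ball 0 r \<times> UNIV) (\<lambda>p. integral (cbox (- (r + R)) 0) (\<lambda>t. src (fst p + t *\<^sub>R dirvec (snd p)) (snd p)))"
    by (rule integral_continuous_on_param) (auto simp: case_prod_unfold intro!: continuous_intros)
  then show "continuous_on (ball 0 r \<times> UNIV) (\<lambda>p. prim (fst p) (snd p))"
    by (rule continuous_on_eq) (auto simp: prim_eq[where N = "r + R"])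
qed

lemma continuous_prim [continuous_intros]:
  "continuous_on X g \<Longrightarrow> continuous_on X h \<Longrightarrow> continuous_on X (\<lambda>p. prim (g p) (h p))"
  by (rule continuous_on_compose2[OF continuous_prim_pair, of X "\<lambda>p. (g p, h p)", simplified])
     (intro continuous_on_Pair)

text \<open>From a point outside the open ball of radius \<open>R\<close>, at least one half of the
  line avoids that ball. If it is the backward half, the integral is 0 at once; otherwise
  \<open>prim\<close> is the integral over the full line, and the equality of the data makes it
  0.\<close>

lemma prim_supp:
  assumes "norm x \<ge> R"
  shows "prim x \<phi> = 0"
proof -
  have far: "src (x + t *\<^sub>R dirvec \<phi>) \<phi> = 0" if "t * (x \<bullet> dirvec \<phi>) \<ge> 0" for t
  proof (rule src_supp)
    have "(norm (x + t *\<^sub>R dirvec \<phi>))\<^sup>2 = (norm x)\<^sup>2 + 2 * (t * (x \<bullet> dirvec \<phi>)) + t\<^sup>2"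
      unfolding power2_norm_eq_inner
      by (simp add: inner_add_left inner_add_right inner_commute power2_eq_square)
    then have "(norm x)\<^sup>2 \<le> (norm (x + t *\<^sub>R dirvec \<phi>))\<^sup>2" using that by simp
    from power2_le_imp_le[OF this norm_ge_zero] assms show "R \<le> norm (x + t *\<^sub>R dirvec \<phi>)" by linarith
  qed
  show ?thesis
  proof (cases "x \<bullet> dirvec \<phi> \<le> 0")
    case True
    have "prim x \<phi> = integral {} (\<lambda>t. src (x + t *\<^sub>R dirvec \<phi>) \<phi>)"
      unfolding prim_def using True by (intro integral_eq_of_support far) (auto simp: zero_le_mult_iff)
    then show ?thesis by simp
  next
    case False
    have "prim x \<phi> = integral UNIV (\<lambda>t. src (x + t *\<^sub>R dirvec \<phi>) \<phi>)"
      unfolding prim_def using False by (intro integral_eq_of_support far) (auto simp: zero_le_mult_iff)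
    then show ?thesis using ray_zero[of \<phi> x] by (simp add: src_def)
  qed
qed

section \<open>The integrating factor without negative modes\<close>

lemma beam_line:
  assumes "norm x + R \<le> M" "\<tau> \<le> M"
  shows "beam (x + \<tau> *\<^sub>R dirvec \<phi>) \<phi> = integral {\<tau>..M} (\<lambda>s. a (x + s *\<^sub>R dirvec \<phi>))"
proof -
  have "beam (x + \<tau> *\<^sub>R dirvec \<phi>) \<phi> = integral {0..} (\<lambda>t. a (x + (t + \<tau>) *\<^sub>R dirvec \<phi>))"
    unfolding beam_def by (simp add: algebra_simps)
  also have "\<dots> = integral {\<tau> - \<tau>..M - \<tau>} (\<lambda>t. a (x + (t + \<tau>) *\<^sub>R dirvec \<phi>))"
    using assms by (intro integral_eq_of_support supp norm_add_scaleR_dirvec_ge) auto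
  also have "\<dots> = integral {\<tau>..M} (\<lambda>s. a (x + s *\<^sub>R dirvec \<phi>))"
    by (rule integral_shift_real_ivl)
  finally show ?thesis .
qed

lemma beam_line_opposite:
  assumes "norm x + R \<le> M" "- M \<le> \<tau>"
  shows "beam (x + \<tau> *\<^sub>R dirvec \<phi>) (\<phi> + pi) = integral {-M..\<tau>} (\<lambda>s. a (x + s *\<^sub>R dirvec \<phi>))"
proof -
  have "x + \<tau> *\<^sub>R dirvec \<phi> = x + (- \<tau>) *\<^sub>R dirvec (\<phi> + pi)" by simp
  then have "beam (x + \<tau> *\<^sub>R dirvec \<phi>) (\<phi> + pi) = integral {- \<tau>..M} (\<lambda>s. a (x + s *\<^sub>R dirvec (\<phi> + pi)))"
    using beam_line[OF assms(1), of "- \<tau>" "\<phi> + pi"] assms(2) by (simp only:)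
  also have "\<dots> = integral {- \<tau>..- (- M)} (\<lambda>s. a (x + (- s) *\<^sub>R dirvec \<phi>))" by simp
  also have "\<dots> = integral {-M..\<tau>} (\<lambda>s. a (x + s *\<^sub>R dirvec \<phi>))"
    by (rule Henstock_Kurzweil_Integration.integral_reflect_real)
  finally show ?thesis .
qed

text \<open>The real part is half the integral of \<open>a\<close> over the whole line, the
  imaginary part is invariant by \<open>hilb_translate\<close>: both are constant along the
  line.\<close>

definition line_fac :: "pt \<Rightarrow> real \<Rightarrow> complex" where
  "line_fac x \<phi> = complex_of_real ((beam x \<phi> + beam x (\<phi> + pi)) / 2) + \<i> * complex_of_real (hilb x \<phi>)"

lemma continuous_line_fac [continuous_intros]:
  "continuous_on X g \<Longrightarrow> continuous_on X h \<Longrightarrow> continuous_on X (\<lambda>p. line_fac (g p) (h p))"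
  unfolding line_fac_def by (intro continuous_intros) auto

lemma beam_periodic_pi: "beam x (\<phi> + 2 * pi + pi) = beam x (\<phi> + pi)"
proof -
  have "\<phi> + 2 * pi + pi = (\<phi> + pi) + 2 * pi" by simp
  then show ?thesis by (simp only: beam_periodic)
qed

lemma line_fac_periodic [simp]: "line_fac x (\<phi> + 2 * pi) = line_fac x \<phi>"
  by (simp only: line_fac_def beam_periodic beam_periodic_pi hilb_periodic)

lemma line_fac_translate: "line_fac (x + \<tau> *\<^sub>R dirvec \<phi>) \<phi> = line_fac x \<phi>"
proof -
  define M where "M = norm x + R + \<bar>\<tau>\<bar>"
  have M: "norm x + R \<le> M" "\<tau> \<le> M" "- M \<le> \<tau>" "0 \<le> M" "- M \<le> 0" using R_pos norm_ge_zero[of x] by (auto simp: M_def simp del: norm_ge_zero)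
  have "beam (x + t *\<^sub>R dirvec \<phi>) \<phi> + beam (x + t *\<^sub>R dirvec \<phi>) (\<phi> + pi) = integral {-M..M} (\<lambda>s. a (x + s *\<^sub>R dirvec \<phi>))"
    if "- M \<le> t" "t \<le> M" for t
    unfolding beam_line[OF M(1) that(2)] beam_line_opposite[OF M(1) that(1)]
    using that by (subst add.commute)
      (intro Henstock_Kurzweil_Integration.integral_combine integrable_continuous_real continuous_intros)
  from this[of \<tau>] this[of 0] M show ?thesis by (simp add: line_fac_def hilb_translate)
qed

text \<open>This is \<open>h\<close> of the overview: \<open>- beam\<close> carries the whole
  derivative \<open>a\<close>, and \<open>line_fac\<close> only corrects the modes.\<close>

definition hol_fac :: "pt \<Rightarrow> real \<Rightarrow> complex" where
  "hol_fac x \<phi> = line_fac x \<phi> - complex_of_real (beam x \<phi>)"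

lemma continuous_hol_fac [continuous_intros]:
  "continuous_on X g \<Longrightarrow> continuous_on X h \<Longrightarrow> continuous_on X (\<lambda>p. hol_fac (g p) (h p))"
  unfolding hol_fac_def by (intro continuous_intros)

lemma hol_fac_periodic [simp]: "hol_fac x (\<phi> + 2 * pi) = hol_fac x \<phi>"
  by (simp add: hol_fac_def)

text \<open>On even modes the half turn changes nothing and \<open>hilb\<close> contributes nothing.
  On odd modes \<open>- fcoeff b k\<close> from the beam meets
  \<open>\<i> * (- \<i>) * fcoeff b k\<close> from \<open>hilb\<close>.\<close>

lemma fcoeff_hol_fac:
  assumes "k < 0"
  shows "fcoeff (hol_fac x) k = 0"
proof -
  define b where "b = (\<lambda>\<phi>. complex_of_real (beam x \<phi>))"
  define w where "w = (\<lambda>\<phi>. complex_of_real (hilb x \<phi>))"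
  have cb: "continuous_on UNIV b" and cw: "continuous_on UNIV w"
    unfolding b_def w_def by (auto intro!: continuous_intros)
  have pb: "b (\<phi> + 2 * pi) = b \<phi>" for \<phi> by (simp add: b_def)
  have cb': "continuous_on UNIV (\<lambda>\<phi>. b (\<phi> + pi))" unfolding b_def by (auto intro!: continuous_intros)
  have "hol_fac x = (\<lambda>\<phi>. ((1/2) * b (\<phi> + pi) - (1/2) * b \<phi>) + \<i> * w \<phi>)"
    by (auto simp: fun_eq_iff hol_fac_def line_fac_def b_def w_def field_simps)
  then have "fcoeff (hol_fac x) k = ((1/2) * fcoeff (\<lambda>\<phi>. b (\<phi> + pi)) k - (1/2) * fcoeff b k) + \<i> * fcoeff w k"
    using cb cw cb' by (simp only: fcoeff_add fcoeff_diff fcoeff_cmult continuous_intros)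
  also have "fcoeff (\<lambda>\<phi>. b (\<phi> + pi)) k = cis (of_int k * pi) * fcoeff b k"
    by (rule fcoeff_shift[OF cb pb])
  also have "cis (of_int k * pi) = (if even k then 1 else - 1)"
    by (auto simp: complex_eq_iff cos_int_times_real sin_int_times_real cos_npi_int sin_npi_int mult.commute)
  also have "fcoeff w k = (if even k then 0 else - \<i> * fcoeff b k)"
    unfolding w_def b_def by (rule fcoeff_hilb[OF assms])
  finally show ?thesis by auto
qed

lemma fcoeff_exp_hol_fac: "k < 0 \<Longrightarrow> fcoeff (\<lambda>\<phi>. exp (hol_fac x \<phi>)) k = 0"
  by (rule fcoeff_nonneg_exp) (auto intro!: continuous_intros fcoeff_hol_fac)

lemma fcoeff_exp_minus_hol_fac: "k < 0 \<Longrightarrow> fcoeff (\<lambda>\<phi>. exp (- hol_fac x \<phi>)) k = 0"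
  using fcoeff_cmult[of "-1" "hol_fac x"]
  by (intro fcoeff_nonneg_exp) (auto intro!: continuous_intros simp: fcoeff_hol_fac)

text \<open>This is \<open>p\<close> of the overview, written as a factor constant along lines times
  a line primitive, so that no derivative of \<open>hol_fac\<close> is ever taken.\<close>

definition hprim :: "pt \<Rightarrow> real \<Rightarrow> complex" where
  "hprim x \<phi> = exp (line_fac x \<phi>) * complex_of_real (prim x \<phi>)"

definition hsrc :: "pt \<Rightarrow> real \<Rightarrow> complex" where
  "hsrc x \<phi> = exp (line_fac x \<phi>) * complex_of_real (src x \<phi>)"

lemma continuous_hprim [continuous_intros]:
  "continuous_on X g \<Longrightarrow> continuous_on X h \<Longrightarrow> continuous_on X (\<lambda>p. hprim (g p) (h p))"
  unfolding hprim_def by (intro continuous_intros)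

lemma continuous_hsrc [continuous_intros]:
  fixes g :: "'b::t2_space \<Rightarrow> pt"
  shows "continuous_on X g \<Longrightarrow> continuous_on X h \<Longrightarrow> continuous_on X (\<lambda>p. hsrc (g p) (h p))"
  unfolding hsrc_def by (intro continuous_intros)

lemma hprim_supp: "norm x \<ge> R \<Longrightarrow> hprim x \<phi> = 0" and hsrc_supp: "norm x \<ge> R \<Longrightarrow> hsrc x \<phi> = 0"
  by (simp_all add: hprim_def hsrc_def prim_supp src_supp)

lemma hprim_periodic [simp]: "hprim x (\<phi> + 2 * pi) = hprim x \<phi>"
  by (simp add: hprim_def)

text \<open>The transport equation for \<open>p\<close> in integrated form: \<open>line_fac\<close>
  is constant along the line and comes out of the integral.\<close>

lemma hprim_line:
  assumes "\<tau> \<ge> 0"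
  shows "hprim (x + \<tau> *\<^sub>R dirvec \<phi>) \<phi> = hprim x \<phi> + integral {0..\<tau>} (\<lambda>s. hsrc (x + s *\<^sub>R dirvec \<phi>) \<phi>)"
proof -
  define M where "M = norm x + R"
  define l where "l = (\<lambda>s. src (x + s *\<^sub>R dirvec \<phi>) \<phi>)"
  have M: "M \<ge> 0" using R_pos norm_ge_zero[of x] by (auto simp: M_def simp del: norm_ge_zero)
  have int: "l integrable_on {c..d}" for c d
    unfolding l_def by (intro integrable_continuous_real continuous_intros)
  have "prim (x + \<tau> *\<^sub>R dirvec \<phi>) \<phi> = integral {-M..\<tau>} l"
    unfolding l_def by (rule prim_line) (use M assms in \<open>auto simp: M_def\<close>)
  also have "\<dots> = integral {-M..0} l + integral {0..\<tau>} l"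
    by (rule Henstock_Kurzweil_Integration.integral_combine[symmetric]) (use M assms int in auto)
  also have "integral {-M..0} l = prim x \<phi>" unfolding l_def by (rule prim_eq[symmetric]) (simp add: M_def)
  finally have "complex_of_real (prim (x + \<tau> *\<^sub>R dirvec \<phi>) \<phi>) = complex_of_real (prim x \<phi>) + complex_of_real (integral {0..\<tau>} l)"
    by simp
  also have "complex_of_real (integral {0..\<tau>} l) = integral {0..\<tau>} (\<lambda>s. complex_of_real (l s))"
    by (rule integral_linear[OF int bounded_linear_of_real, unfolded o_def, symmetric])
  finally show ?thesis
    unfolding hprim_def hsrc_def line_fac_translate by (simp add: distrib_left l_def)
qed

lemma fcoeff_hsrc:
  assumes "k \<le> - 2"
  shows "fcoeff (hsrc x) k = 0"
proof -
  define E where "E = (\<lambda>\<phi>. exp (hol_fac x \<phi>))"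
  have cE: "continuous_on UNIV E" unfolding E_def by (intro continuous_intros)
  have E0: "fcoeff E j = 0" if "j < 0" for j unfolding E_def by (rule fcoeff_exp_hol_fac[OF that])
  \<comment> \<open>Euler coefficients of \<open>dirvec \<phi> \<bullet> F x\<close> at the
    frequencies 1 and -1. The lower one is the only source of negative modes, hence the threshold
    -2.\<close>
  define A where "A = (complex_of_real (F x $ 1) - \<i> * complex_of_real (F x $ 2)) / 2"
  define B where "B = (complex_of_real (F x $ 1) + \<i> * complex_of_real (F x $ 2)) / 2"
  have "complex_of_real (dirvec \<phi> \<bullet> F x - f x)
     = A * cis (of_int 1 * \<phi>) + B * cis (of_int (-1) * \<phi>) + - complex_of_real (f x) * cis (of_int 0 * \<phi>)" for \<phi>
    by (simp add: complex_eq_iff A_def B_def dirvec_def inner_vec_def sum_2 field_simps)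
  moreover have "hsrc x \<phi> = complex_of_real (dirvec \<phi> \<bullet> F x - f x) * E \<phi>" for \<phi>
    by (simp add: hsrc_def src_def E_def hol_fac_def exp_diff exp_minus exp_of_real field_simps)
  ultimately have "hsrc x = (\<lambda>\<phi>. A * cis (of_int 1 * \<phi>) * E \<phi> + B * cis (of_int (-1) * \<phi>) * E \<phi>
     + - complex_of_real (f x) * cis (of_int 0 * \<phi>) * E \<phi>)"
    by (simp add: fun_eq_iff distrib_right left_diff_distrib)
  then have "fcoeff (hsrc x) k = A * fcoeff E (k - 1) + B * fcoeff E (k - (-1)) + - complex_of_real (f x) * fcoeff E (k - 0)"
    using cE by (simp only: fcoeff_add fcoeff_modulate continuous_intros)
  then show ?thesis using assms by (simp add: E0)
qed

section \<open>Fourier transform of the transport equation in the space variable\<close>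

definition big_box :: "pt set" where
  "big_box = cbox (- ((R + 2) *\<^sub>R One)) ((R + 2) *\<^sub>R One)"

lemma mem_big_box: "norm x \<le> R + 2 \<Longrightarrow> x \<in> big_box"
proof -
  assume "norm x \<le> R + 2"
  then have "- (R + 2) \<le> x \<bullet> i \<and> x \<bullet> i \<le> R + 2" if "i \<in> Basis" for i
    using Basis_le_norm[OF that, of x] by linarith
  then show ?thesis by (simp add: big_box_def mem_box)
qed

lemma interior_big_box_nonempty: "box (- ((R + 2) *\<^sub>R One)) ((R + 2) *\<^sub>R One :: pt) \<noteq> {}"
  using R_pos by (auto simp: box_ne_empty)

text \<open>The half-width \<open>R + 2\<close> leaves room for shifts of length at most 1 of a
  function supported in the ball of radius \<open>R\<close>, so no mass crosses the edge.\<close>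

lemma integral_big_box_translate:
  fixes g :: "pt \<Rightarrow> complex"
  assumes g: "\<And>x. norm x \<ge> R \<Longrightarrow> g x = 0" and c: "norm c \<le> 1"
  shows "integral big_box (\<lambda>x. g (x + c)) = integral big_box g"
proof -
  let ?l = "- ((R + 2) *\<^sub>R One)" and ?u = "(R + 2) *\<^sub>R One :: pt"
  have "integral big_box (\<lambda>x. g (x + c)) = integral (cbox (?l - c) (?u - c)) (\<lambda>x. g (x + c))"
  proof (rule integral_eq_of_support)
    fix x assume "x \<notin> cbox (?l - c) (?u - c)"
    then have "x + c \<notin> big_box" by (auto simp: big_box_def mem_box inner_diff_left inner_add_left algebra_simps)
    then have "R + 2 < norm (x + c)" using mem_big_box[of "x + c"] by force
    then show "g (x + c) = 0" by (intro g) simp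
  next
    fix x assume "x \<notin> big_box"
    then have "R + 2 < norm x" using mem_big_box[of x] by force
    then have "R \<le> norm (x + c)" using c norm_diff_ineq[of x c] by linarith
    then show "g (x + c) = 0" by (rule g)
  qed
  also have "\<dots> = integral big_box g" unfolding big_box_def by (rule integral_shift_cbox)
  finally show ?thesis .
qed

definition hprim_hat :: "pt \<Rightarrow> real \<Rightarrow> complex" where
  "hprim_hat \<xi> \<phi> = integral big_box (\<lambda>x. hprim x \<phi> * cis (- (\<xi> \<bullet> x)))"

definition hsrc_hat :: "pt \<Rightarrow> real \<Rightarrow> complex" where
  "hsrc_hat \<xi> \<phi> = integral big_box (\<lambda>x. hsrc x \<phi> * cis (- (\<xi> \<bullet> x)))"

lemma transform_translate:
  fixes g :: "pt \<Rightarrow> complex"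
  assumes g: "\<And>x. norm x \<ge> R \<Longrightarrow> g x = 0" and "\<bar>s\<bar> \<le> 1"
  shows "integral big_box (\<lambda>x. g (x + s *\<^sub>R dirvec \<phi>) * cis (- (\<xi> \<bullet> x)))
    = cis (s * (\<xi> \<bullet> dirvec \<phi>)) * integral big_box (\<lambda>x. g x * cis (- (\<xi> \<bullet> x)))"
proof -
  have "integral big_box (\<lambda>x. g (x + s *\<^sub>R dirvec \<phi>) * cis (- (\<xi> \<bullet> x)))
     = integral big_box (\<lambda>x. cis (s * (\<xi> \<bullet> dirvec \<phi>)) * (g (x + s *\<^sub>R dirvec \<phi>) * cis (- (\<xi> \<bullet> (x + s *\<^sub>R dirvec \<phi>)))))"
  proof (rule arg_cong[where f = "integral big_box"], rule ext)
    fix x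
    have "cis (- (\<xi> \<bullet> x)) = cis (s * (\<xi> \<bullet> dirvec \<phi>)) * cis (- (\<xi> \<bullet> (x + s *\<^sub>R dirvec \<phi>)))"
      by (simp add: cis_mult inner_add_right)
    then show "g (x + s *\<^sub>R dirvec \<phi>) * cis (- (\<xi> \<bullet> x))
      = cis (s * (\<xi> \<bullet> dirvec \<phi>)) * (g (x + s *\<^sub>R dirvec \<phi>) * cis (- (\<xi> \<bullet> (x + s *\<^sub>R dirvec \<phi>))))"
      by simp
  qed
  also have "\<dots> = cis (s * (\<xi> \<bullet> dirvec \<phi>)) *
      integral big_box (\<lambda>x. g (x + s *\<^sub>R dirvec \<phi>) * cis (- (\<xi> \<bullet> (x + s *\<^sub>R dirvec \<phi>))))"
    by (rule integral_mult_right)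
  also have "integral big_box (\<lambda>x. g (x + s *\<^sub>R dirvec \<phi>) * cis (- (\<xi> \<bullet> (x + s *\<^sub>R dirvec \<phi>))))
      = integral big_box (\<lambda>x. g x * cis (- (\<xi> \<bullet> x)))"
    by (rule integral_big_box_translate[of "\<lambda>x. g x * cis (- (\<xi> \<bullet> x))"]) (use assms in auto)
  finally show ?thesis .
qed

text \<open>Instead of differentiating, \<open>hprim_line\<close> is transformed for a finite step.
  For nonzero \<open>c\<close> this gives the claim multiplied by
  \<open>cis (\<tau> * c) - 1\<close>, which is then cancelled.\<close>

lemma transform_transport: "\<i> * complex_of_real (\<xi> \<bullet> dirvec \<phi>) * hprim_hat \<xi> \<phi> = hsrc_hat \<xi> \<phi>"
proof -
  define c where "c = \<xi> \<bullet> dirvec \<phi>"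
  have main: "cis (\<tau> * c) * hprim_hat \<xi> \<phi> = hprim_hat \<xi> \<phi> + integral {0..\<tau>} (\<lambda>s. cis (s * c)) * hsrc_hat \<xi> \<phi>"
    if "0 < \<tau>" "\<tau> \<le> 1" for \<tau>
  proof -
    have "cis (\<tau> * c) * hprim_hat \<xi> \<phi> = integral big_box (\<lambda>x. hprim (x + \<tau> *\<^sub>R dirvec \<phi>) \<phi> * cis (- (\<xi> \<bullet> x)))"
      unfolding c_def hprim_hat_def by (rule transform_translate[symmetric]) (use that hprim_supp in auto)
    also have "\<dots> = integral big_box (\<lambda>x. hprim x \<phi> * cis (- (\<xi> \<bullet> x))
        + integral {0..\<tau>} (\<lambda>s. hsrc (x + s *\<^sub>R dirvec \<phi>) \<phi> * cis (- (\<xi> \<bullet> x))))"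
      using that by (simp add: hprim_line distrib_right)
    also have "\<dots> = hprim_hat \<xi> \<phi> + integral big_box (\<lambda>x. integral {0..\<tau>} (\<lambda>s. hsrc (x + s *\<^sub>R dirvec \<phi>) \<phi> * cis (- (\<xi> \<bullet> x))))"
      unfolding hprim_hat_def big_box_def cbox_interval[symmetric]
      by (intro Henstock_Kurzweil_Integration.integral_add integrable_continuous integral_continuous_on_param)
         (auto simp: case_prod_unfold intro!: continuous_intros)
    also have "integral big_box (\<lambda>x. integral {0..\<tau>} (\<lambda>s. hsrc (x + s *\<^sub>R dirvec \<phi>) \<phi> * cis (- (\<xi> \<bullet> x))))
       = integral {0..\<tau>} (\<lambda>s. integral big_box (\<lambda>x. hsrc (x + s *\<^sub>R dirvec \<phi>) \<phi> * cis (- (\<xi> \<bullet> x))))"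
      unfolding big_box_def cbox_interval[symmetric]
      by (rule integral_swap_continuous) (auto simp: case_prod_unfold intro!: continuous_intros)
    also have "\<dots> = integral {0..\<tau>} (\<lambda>s. cis (s * c) * hsrc_hat \<xi> \<phi>)"
      by (rule Henstock_Kurzweil_Integration.integral_cong)
         (unfold hsrc_hat_def c_def, rule transform_translate, use that hsrc_supp in auto)
    also have "\<dots> = integral {0..\<tau>} (\<lambda>s. cis (s * c)) * hsrc_hat \<xi> \<phi>" by (rule integral_mult_left)
    finally show ?thesis .
  qed
  show ?thesis
  proof (cases "c = 0")
    case True
    \<comment> \<open>In a direction orthogonal to the frequency the shift leaves the transform
      unchanged, and a step of length 1 isolates the source.\<close>
    from main[of 1] True have "hsrc_hat \<xi> \<phi> = 0" by simp
    then show ?thesis using True by (simp add: c_def)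
  next
    case False
    \<comment> \<open>The bound 1 keeps the shift inside the margin of the box; the bound
      \<open>1 / \<bar>c\<bar>\<close> keeps \<open>\<tau> * c\<close> within a range where
      \<open>cis\<close> is 1 only at 0.\<close>
    define \<tau> where "\<tau> = min 1 (1 / \<bar>c\<bar>)"
    have \<tau>: "0 < \<tau>" "\<tau> \<le> 1" "\<bar>\<tau> * c\<bar> \<le> 1" "\<tau> * c \<noteq> 0"
      using False by (auto simp: \<tau>_def min_def abs_mult field_simps)
    have "((\<lambda>s. cis (s * c)) has_integral (cis (\<tau> * c) / (\<i> * c) - cis (0 * c) / (\<i> * c))) {0..\<tau>}"
    proof (rule fundamental_theorem_of_calculus)
      fix x assume "x \<in> {0..\<tau>}"
      have "((\<lambda>z. exp (\<i> * (z * c)) / (\<i> * c)) has_field_derivative exp (\<i> * (of_real x * c))) (at (of_real x))"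
        using False by (auto intro!: derivative_eq_intros simp: field_simps)
      from has_vector_derivative_real_field[OF this]
      show "((\<lambda>s. cis (s * c) / (\<i> * c)) has_vector_derivative cis (x * c)) (at x within {0..\<tau>})"
        by (simp add: cis_conv_exp)
    qed (use \<tau> in auto)
    then have "integral {0..\<tau>} (\<lambda>s. cis (s * c)) = (cis (\<tau> * c) - 1) / (\<i> * c)"
      by (simp add: integral_unique diff_divide_distrib)
    with main[OF \<tau>(1,2)] have "(cis (\<tau> * c) - 1) * hprim_hat \<xi> \<phi> = (cis (\<tau> * c) - 1) / (\<i> * c) * hsrc_hat \<xi> \<phi>"
      by (simp add: left_diff_distrib)
    then have "(cis (\<tau> * c) - 1) * (\<i> * c * hprim_hat \<xi> \<phi>) = (cis (\<tau> * c) - 1) * hsrc_hat \<xi> \<phi>"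
      using False by (simp add: field_simps)
    moreover have "cis (\<tau> * c) \<noteq> 1"
    proof
      assume "cis (\<tau> * c) = 1"
      then have "sin (\<tau> * c) = 0" by (simp add: complex_eq_iff)
      moreover have "\<bar>\<tau> * c\<bar> < pi" using \<tau>(3) pi_gt3 by linarith
      ultimately show False using \<tau>(4) sin_eq_0_pi[of "\<tau> * c"] by (simp add: abs_less_iff)
    qed
    ultimately show ?thesis by (simp add: c_def)
  qed
qed

lemma fcoeff_hprim_hat: "fcoeff (hprim_hat \<xi>) k = integral big_box (\<lambda>x. fcoeff (hprim x) k * cis (- (\<xi> \<bullet> x)))"
proof -
  have "fcoeff (hprim_hat \<xi>) k = integral {0..2*pi} (\<lambda>\<phi>. integral big_box (\<lambda>x. hprim x \<phi> * cis (- (of_int k * \<phi>)) * cis (- (\<xi> \<bullet> x))))"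
    unfolding fcoeff_def hprim_hat_def by (simp add: mult_ac flip: integral_mult_right)
  also have "\<dots> = integral big_box (\<lambda>x. integral {0..2*pi} (\<lambda>\<phi>. hprim x \<phi> * cis (- (of_int k * \<phi>)) * cis (- (\<xi> \<bullet> x))))"
    unfolding big_box_def cbox_interval[symmetric]
    by (rule integral_swap_continuous) (auto simp: case_prod_unfold intro!: continuous_intros)
  also have "\<dots> = integral big_box (\<lambda>x. fcoeff (hprim x) k * cis (- (\<xi> \<bullet> x)))"
    unfolding fcoeff_def by simp
  finally show ?thesis .
qed

lemma fcoeff_hsrc_hat: "fcoeff (hsrc_hat \<xi>) k = integral big_box (\<lambda>x. fcoeff (hsrc x) k * cis (- (\<xi> \<bullet> x)))"
proof -
  have "fcoeff (hsrc_hat \<xi>) k = integral {0..2*pi} (\<lambda>\<phi>. integral big_box (\<lambda>x. hsrc x \<phi> * cis (- (of_int k * \<phi>)) * cis (- (\<xi> \<bullet> x))))"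
    unfolding fcoeff_def hsrc_hat_def by (simp add: mult_ac flip: integral_mult_right)
  also have "\<dots> = integral big_box (\<lambda>x. integral {0..2*pi} (\<lambda>\<phi>. hsrc x \<phi> * cis (- (of_int k * \<phi>)) * cis (- (\<xi> \<bullet> x))))"
    unfolding big_box_def cbox_interval[symmetric]
    by (rule integral_swap_continuous) (auto simp: case_prod_unfold intro!: continuous_intros)
  also have "\<dots> = integral big_box (\<lambda>x. fcoeff (hsrc x) k * cis (- (\<xi> \<bullet> x)))"
    unfolding fcoeff_def by simp
  finally show ?thesis .
qed

lemma continuous_hprim_hat: "continuous_on X (hprim_hat \<xi>)"
  unfolding hprim_hat_def big_box_def
  by (rule integral_continuous_on_param) (auto simp: case_prod_unfold intro!: continuous_intros)

lemma hprim_hat_periodic: "hprim_hat \<xi> (\<phi> + 2 * pi) = hprim_hat \<xi> \<phi>"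
  by (simp add: hprim_hat_def)

text \<open>At negative frequencies the transport equation preserves the modulus of every second mode,
  while the modes tend to \<open>0\<close>.\<close>

lemma fcoeff_hprim_hat_zero:
  assumes "\<xi> \<noteq> 0" "k < 0"
  shows "fcoeff (hprim_hat \<xi>) k = 0"
proof -
  \<comment> \<open>The frequency as a complex number: \<open>\<xi> \<bullet> dirvec \<phi>\<close>
    is the real part of \<open>cnj \<zeta> * cis \<phi>\<close>, so its two modes have coefficients
    of equal modulus.\<close>
  define \<zeta> where "\<zeta> = Complex (\<xi> $ 1) (\<xi> $ 2)"
  have "\<zeta> \<noteq> 0" using assms(1) by (auto simp: \<zeta>_def complex_eq_iff vec_eq_iff forall_2)
  have inner: "\<i> * complex_of_real (\<xi> \<bullet> dirvec \<phi>) = (\<i> * cnj \<zeta> / 2) * cis (of_int 1 * \<phi>) + (\<i> * \<zeta> / 2) * cis (of_int (-1) * \<phi>)" for \<phi>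
    by (simp add: complex_eq_iff \<zeta>_def dirvec_def inner_vec_def sum_2 field_simps)
  have rec: "cnj \<zeta> * fcoeff (hprim_hat \<xi>) (n - 1) + \<zeta> * fcoeff (hprim_hat \<xi>) (n + 1) = 0" if "n \<le> - 2" for n
  proof -
    have "fcoeff (hsrc_hat \<xi>) n = 0" unfolding fcoeff_hsrc_hat by (simp add: fcoeff_hsrc that)
    moreover have "hsrc_hat \<xi> = (\<lambda>\<phi>. (\<i> * cnj \<zeta> / 2) * cis (of_int 1 * \<phi>) * hprim_hat \<xi> \<phi> + (\<i> * \<zeta> / 2) * cis (of_int (-1) * \<phi>) * hprim_hat \<xi> \<phi>)"
      unfolding transform_transport[symmetric] inner by (simp add: fun_eq_iff distrib_right)
    ultimately have "(\<i> * cnj \<zeta> / 2) * fcoeff (hprim_hat \<xi>) (n - 1) + (\<i> * \<zeta> / 2) * fcoeff (hprim_hat \<xi>) (n - (-1)) = 0"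
      by (simp only: fcoeff_add fcoeff_modulate continuous_intros continuous_hprim_hat)
    then have "(\<i> / 2) * (cnj \<zeta> * fcoeff (hprim_hat \<xi>) (n - 1) + \<zeta> * fcoeff (hprim_hat \<xi>) (n + 1)) = 0"
      by (simp add: algebra_simps)
    then show ?thesis by simp
  qed
  \<comment> \<open>For \<open>m < 0\<close> the index \<open>m - 1\<close> is at most -2, so the
    recursion applies at every negative mode and ties it to the one two below.\<close>
  have eq: "norm (fcoeff (hprim_hat \<xi>) (m - 2)) = norm (fcoeff (hprim_hat \<xi>) m)" if "m < 0" for m
  proof -
    have "cnj \<zeta> * fcoeff (hprim_hat \<xi>) (m - 2) = - (\<zeta> * fcoeff (hprim_hat \<xi>) m)"
      using rec[of "m - 1"] that by (simp add: eq_neg_iff_add_eq_0)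
    then have "norm (cnj \<zeta> * fcoeff (hprim_hat \<xi>) (m - 2)) = norm (\<zeta> * fcoeff (hprim_hat \<xi>) m)" by simp
    then show ?thesis using \<open>\<zeta> \<noteq> 0\<close> by (simp add: norm_mult)
  qed
  have it: "norm (fcoeff (hprim_hat \<xi>) (k - 2 * int j)) = norm (fcoeff (hprim_hat \<xi>) k)" for j
  proof (induction j)
    case (Suc j)
    then show ?case using eq[of "k - 2 * int j"] assms(2) by (simp add: algebra_simps)
  qed simp
  have "norm (fcoeff (hprim_hat \<xi>) k) < e" if e: "e > 0" for e
  proof -
    obtain N where N: "\<And>k. \<bar>k\<bar> > N \<Longrightarrow> norm (fcoeff (hprim_hat \<xi>) k) < e"
      using fcoeff_riemann_lebesgue[OF continuous_hprim_hat hprim_hat_periodic e] by blast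
    \<comment> \<open>Since \<open>k < 0\<close>, going down only increases the absolute value, and
      this many steps exceed \<open>N\<close> whatever its sign.\<close>
    have "\<bar>k - 2 * int (nat \<bar>N\<bar> + 1)\<bar> > N" using assms(2) by simp
    from N[OF this] show ?thesis by (simp only: it)
  qed
  then show ?thesis by (metis less_irrefl zero_less_norm_iff)
qed

lemma fcoeff_hprim:
  assumes "k < 0"
  shows "fcoeff (hprim x) k = 0"
proof (cases "x \<in> big_box")
  case True
  show ?thesis
  proof (rule fourier_transform_injective[OF _ interior_big_box_nonempty, where u = "\<lambda>x. fcoeff (hprim x) k"])
    show "continuous_on (cbox (- ((R + 2) *\<^sub>R One)) ((R + 2) *\<^sub>R One)) (\<lambda>x. fcoeff (hprim x) k)"
      unfolding fcoeff_def cbox_interval[symmetric]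
      by (rule integral_continuous_on_param) (auto simp: case_prod_unfold intro!: continuous_intros)
    show "integral (cbox (- ((R + 2) *\<^sub>R One)) ((R + 2) *\<^sub>R One)) (\<lambda>x. fcoeff (hprim x) k * cis (- (\<xi> \<bullet> x))) = 0"
      if "\<xi> \<noteq> 0" for \<xi> using fcoeff_hprim_hat_zero[OF that assms] by (simp add: fcoeff_hprim_hat big_box_def)
    show "x \<in> cbox (- ((R + 2) *\<^sub>R One)) ((R + 2) *\<^sub>R One)" using True by (simp add: big_box_def)
  qed
next
  case False
  then have "R \<le> norm x" using mem_big_box[of x] by force
  then show ?thesis by (simp add: fcoeff_def hprim_supp)
qed

section \<open>Independence of the direction, and the potential\<close>

definition sol :: "pt \<Rightarrow> real \<Rightarrow> real" where
  "sol x \<phi> = exp (beam x \<phi>) * prim x \<phi>"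

lemma sol_const: "sol x \<phi> = sol x 0"
proof -
  define V where "V = (\<lambda>\<phi>. complex_of_real (sol x \<phi>))"
  have cV: "continuous_on UNIV V" unfolding V_def sol_def by (intro continuous_intros)
  have pV: "V (\<phi> + 2 * pi) = V \<phi>" for \<phi> by (simp add: V_def sol_def)
  have "V = (\<lambda>\<phi>. exp (- hol_fac x \<phi>) * hprim x \<phi>)"
    by (simp add: fun_eq_iff V_def sol_def hprim_def hol_fac_def exp_diff exp_of_real)
  moreover have "fcoeff (\<lambda>\<phi>. exp (- hol_fac x \<phi>) * hprim x \<phi>) k = 0" if "k < 0" for k
    by (rule fcoeff_nonneg_mult)
       (auto intro!: continuous_intros fcoeff_exp_minus_hol_fac fcoeff_hprim that)
  ultimately have neg: "fcoeff V k = 0" if "k < 0" for k using that by simp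
  have pos: "fcoeff V k = 0" if "k > 0" for k
    using neg[of "- k"] that fcoeff_of_real_minus[of "sol x" k] by (simp add: V_def)
  \<comment> \<open>The mean value of \<open>V\<close>: division by \<open>2 * pi\<close> accounts
    for \<open>fcoeff\<close> being unnormalised.\<close>
  define m where "m = fcoeff V 0 / complex_of_real (2 * pi)"
  have "fcoeff (\<lambda>\<phi>. V \<phi> - m) k = 0" for k
  proof -
    have "fcoeff (\<lambda>\<phi>. V \<phi> - m * 1) k = fcoeff V k - m * fcoeff (\<lambda>\<phi>. 1) k"
      using fcoeff_diff[OF cV, of "\<lambda>_. m * 1" k] fcoeff_cmult[of m "\<lambda>_. 1" k] by simp
    then show ?thesis using neg[of k] pos[of k] by (cases k "0::int" rule: linorder_cases) (auto simp: fcoeff_one m_def)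
  qed
  then have "V \<phi> - m = 0" for \<phi>
    by (intro fcoeff_unique[of "\<lambda>\<phi>. V \<phi> - m"]) (auto intro!: continuous_intros cV simp: pV)
  then have "V \<phi> = V 0" by (metis eq_iff_diff_eq_0)
  then show ?thesis by (simp add: V_def)
qed

text \<open>Although \<open>sol\<close> is read at angle 0, \<open>sol_const\<close> allows reading
  it at the angle \<open>\<phi>\<close> of the line, where it is an explicit product of an
  exponential and a primitive.\<close>

lemma sol_derivative:
  "((\<lambda>t. sol (x + t *\<^sub>R dirvec \<phi>) 0) has_real_derivative (dirvec \<phi> \<bullet> F x - f x - a x * sol x 0)) (at 0)"
proof -
  define M where "M = norm x + R + 1"
  have M: "norm x + R \<le> M" "M \<ge> 1" using R_pos norm_ge_zero[of x] by (auto simp: M_def simp del: norm_ge_zero)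
  define la where "la = (\<lambda>s. a (x + s *\<^sub>R dirvec \<phi>))"
  define ls where "ls = (\<lambda>s. src (x + s *\<^sub>R dirvec \<phi>) \<phi>)"
  have cla: "continuous_on X la" and cls: "continuous_on X ls" for X
    unfolding la_def ls_def by (auto intro!: continuous_intros)
  have at0: "at 0 within {-M..M} = at (0::real)" using M by (intro at_within_interior) (auto simp: interior_atLeastAtMost_real)
  have D: "((\<lambda>t. integral {-M..t} g) has_real_derivative g 0) (at 0)" if "\<And>X. continuous_on X g" for g :: "real \<Rightarrow> real"
    using integral_has_real_derivative[OF that, of 0 "-M" M] M at0 by simp
  have ev: "\<forall>\<^sub>F t in nhds 0. t \<in> {-M<..<M}" using M by (intro eventually_nhds_in_open) auto
  have "((\<lambda>t. exp (integral {-M..M} la - integral {-M..t} la) * integral {-M..t} ls) has_real_derivative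
      exp (integral {-M..M} la - integral {-M..0} la) * (- la 0) * integral {-M..0} ls
      + exp (integral {-M..M} la - integral {-M..0} la) * ls 0) (at 0)"
    by (rule derivative_eq_intros D cla cls refl | simp)+
  moreover have eq: "sol (x + t *\<^sub>R dirvec \<phi>) 0 = exp (integral {-M..M} la - integral {-M..t} la) * integral {-M..t} ls"
    if "t \<in> {-M<..<M}" for t
  proof -
    have "integral {-M..t} la + integral {t..M} la = integral {-M..M} la"
      using that by (intro Henstock_Kurzweil_Integration.integral_combine integrable_continuous_real cla) auto
    then have "beam (x + t *\<^sub>R dirvec \<phi>) \<phi> = integral {-M..M} la - integral {-M..t} la"
      using beam_line[OF M(1), of t \<phi>] that by (simp add: la_def)
    moreover have "prim (x + t *\<^sub>R dirvec \<phi>) \<phi> = integral {-M..t} ls"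
      using prim_line[OF M(1), of t \<phi>] that by (simp add: ls_def)
    ultimately show ?thesis unfolding sol_const[of _ \<phi>, symmetric] by (simp add: sol_def)
  qed
  moreover have "exp (integral {-M..M} la - integral {-M..0} la) * (- la 0) * integral {-M..0} ls
      + exp (integral {-M..M} la - integral {-M..0} la) * ls 0 = dirvec \<phi> \<bullet> F x - f x - a x * sol x 0"
  proof -
    have "integral {-M..0} la + integral {0..M} la = integral {-M..M} la"
      using M by (intro Henstock_Kurzweil_Integration.integral_combine integrable_continuous_real cla) auto
    then have b: "integral {-M..M} la - integral {-M..0} la = beam x \<phi>"
      using beam_line[OF M(1), of 0 \<phi>] M by (simp add: la_def)
    have "exp (beam x \<phi>) * ls 0 = dirvec \<phi> \<bullet> F x - f x"
      by (simp add: ls_def src_def exp_minus)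
    moreover have "sol x 0 = exp (beam x \<phi>) * integral {-M..0} ls" using eq[of 0] M b by simp
    ultimately show ?thesis unfolding b by (simp add: la_def)
  qed
  ultimately show ?thesis
    using DERIV_cong_ev[OF refl eventually_mono[OF ev eq] refl] by simp
qed

theorem potential_exists:
  obtains v where "\<And>x. a x * v x = - f x"
    "\<And>x \<phi>. ((\<lambda>t. v (x + t *\<^sub>R dirvec \<phi>)) has_real_derivative dirvec \<phi> \<bullet> F x) (at 0)"
proof
  define v where "v = (\<lambda>x. sol x 0)"
  \<comment> \<open>One pair of opposite directions, 0 and \<open>pi\<close>, suffices: reversal
    changes the sign of the derivative and of the \<open>F\<close> term, so the remaining terms,
    which do not depend on the angle, must cancel.\<close>
  show av: "a x * v x = - f x" for x
  proof -
    have "((\<lambda>t. v (x + t *\<^sub>R dirvec 0)) has_real_derivative (dirvec 0 \<bullet> F x - f x - a x * v x)) (at (- 0))"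
      using sol_derivative[of x 0] by (simp add: v_def)
    from DERIV_chain2[where g = uminus and x = 0 and s = UNIV, OF this DERIV_minus[OF DERIV_ident]]
    have "((\<lambda>t. v (x - t *\<^sub>R dirvec 0)) has_real_derivative - (dirvec 0 \<bullet> F x - f x - a x * v x)) (at 0)"
      by simp
    moreover have "((\<lambda>t. v (x - t *\<^sub>R dirvec 0)) has_real_derivative (- (dirvec 0 \<bullet> F x) - f x - a x * v x)) (at 0)"
      using sol_derivative[of x "0 + pi"] unfolding dirvec_plus_pi by (simp add: v_def)
    ultimately have "- (dirvec 0 \<bullet> F x - f x - a x * v x) = - (dirvec 0 \<bullet> F x) - f x - a x * v x"
      by (rule DERIV_unique)
    then show ?thesis by simp
  qed
  show "((\<lambda>t. v (x + t *\<^sub>R dirvec \<phi>)) has_real_derivative dirvec \<phi> \<bullet> F x) (at 0)" for x \<phi>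
    using sol_derivative[of x \<phi>] av[of x] by (simp add: v_def)
qed

end

section \<open>Functions on the domain\<close>

text \<open>Extension by zero removes the boundary: translations, line integrals and the Fourier
  transform then act on functions on the whole plane.\<close>

definition zext :: "pt set \<Rightarrow> (pt \<Rightarrow> 'b::zero) \<Rightarrow> pt \<Rightarrow> 'b" where
  "zext \<Omega> u x = (if x \<in> \<Omega> then u x else 0)"

text \<open>The Hoelder bound compares the derivative at any point with that at one fixed
  \<open>x0\<close>, and the domain is bounded, so the derivative is bounded. Convexity allows the
  mean value inequality, and continuity carries it to the closure.\<close>

lemma C1alpha0_lipschitz:
  assumes dom: "open \<Omega>" "bounded \<Omega>" "convex \<Omega>" and "\<alpha> > 0" and u: "C1alpha0 \<Omega> \<alpha> u"
  obtains K where "K \<ge> 0" "\<And>x y. x \<in> \<Omega> \<Longrightarrow> y \<in> closure \<Omega> \<Longrightarrow> \<bar>u x - u y\<bar> \<le> K * dist x y"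
proof (cases "\<Omega> = {}")
  case True
  then show ?thesis using that[of 0] by simp
next
  case False
  then obtain x0 where x0: "x0 \<in> \<Omega>" by blast
  obtain u' C where u': "\<And>x. x \<in> \<Omega> \<Longrightarrow> (u has_derivative u' x) (at x)"
    and C: "\<And>x y h. x \<in> \<Omega> \<Longrightarrow> y \<in> \<Omega> \<Longrightarrow> \<bar>u' x h - u' y h\<bar> \<le> C * norm h * dist x y powr \<alpha>"
    using u unfolding C1alpha0_def by blast
  have cont: "continuous_on (closure \<Omega>) u" using u by (simp add: C1alpha0_def)
  obtain D where D: "\<And>x y. x \<in> \<Omega> \<Longrightarrow> y \<in> \<Omega> \<Longrightarrow> dist x y \<le> D"
    using dom(2) unfolding bounded_two_points by blast
  have "bounded_linear (u' x0)" using u'[OF x0] by (rule has_derivative_bounded_linear)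
  then obtain B where B: "\<And>h. norm (u' x0 h) \<le> norm h * B" using bounded_linear.bounded by blast
  define K where "K = \<bar>B\<bar> + \<bar>C\<bar> * D powr \<alpha>"
  have K: "K \<ge> 0" by (simp add: K_def)
  have on: "onorm (u' x) \<le> K" if "x \<in> \<Omega>" for x
  proof (rule onorm_bound[OF K])
    fix h
    have "\<bar>u' x h\<bar> \<le> \<bar>u' x0 h\<bar> + C * norm h * dist x x0 powr \<alpha>" using C[OF that x0, of h] by linarith
    also have "C * norm h * dist x x0 powr \<alpha> \<le> \<bar>C\<bar> * norm h * D powr \<alpha>"
      using D[OF that x0] \<open>\<alpha> > 0\<close> by (intro mult_mono powr_mono2) auto
    also have "\<bar>u' x0 h\<bar> \<le> \<bar>B\<bar> * norm h"
      using B[of h] mult_left_mono[OF abs_ge_self[of B] norm_ge_zero[of h]] by (simp add: mult.commute)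
    finally show "norm (u' x h) \<le> K * norm h" by (simp add: K_def algebra_simps)
  qed
  have int: "\<bar>u x - u y\<bar> \<le> K * dist x y" if "x \<in> \<Omega>" "y \<in> \<Omega>" for x y
    using differentiable_bound[OF dom(3), of u u' K x y] that on u'
    by (auto simp: dist_norm intro: has_derivative_at_withinI)
  have "\<bar>u x - u y\<bar> \<le> K * dist x y" if "x \<in> \<Omega>" "y \<in> closure \<Omega>" for x y
  proof -
    have "0 \<le> K * dist x y - \<bar>u x - u y\<bar>"
      by (rule continuous_ge_on_closure[where S = \<Omega> and f = "\<lambda>y. K * dist x y - \<bar>u x - u y\<bar>"])
         (use that int in \<open>auto intro!: continuous_intros cont\<close>)
    then show ?thesis by simp
  qed
  then show ?thesis using that K by blast
qed

text \<open>A segment leaving the domain crosses the frontier, where \<open>u\<close> is 0;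
  comparison with the crossing point gives the same constant as inside.\<close>

lemma zext_lipschitz:
  assumes dom: "open \<Omega>" "bounded \<Omega>" "convex \<Omega>" and "\<alpha> > 0" and u: "C1alpha0 \<Omega> \<alpha> u"
  obtains K where "\<And>x y. \<bar>zext \<Omega> u x - zext \<Omega> u y\<bar> \<le> K * dist x y"
proof -
  obtain K where K: "K \<ge> 0" "\<And>x y. x \<in> \<Omega> \<Longrightarrow> y \<in> closure \<Omega> \<Longrightarrow> \<bar>u x - u y\<bar> \<le> K * dist x y"
    using C1alpha0_lipschitz[OF assms] by blast
  have out: "\<bar>u x\<bar> \<le> K * dist x y" if "x \<in> \<Omega>" "y \<notin> \<Omega>" for x y
  proof -
    have "closed_segment x y \<inter> frontier \<Omega> \<noteq> {}"
      using that by (intro connected_Int_frontier) auto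
    then obtain z where z: "z \<in> closed_segment x y" "z \<in> frontier \<Omega>" by blast
    have "u z = 0" "z \<in> closure \<Omega>" using u z(2) by (auto simp: C1alpha0_def frontier_def)
    then have "\<bar>u x\<bar> \<le> K * dist x z" using K(2)[OF that(1), of z] by simp
    also have "\<dots> \<le> K * dist x y"
      using z(1) K(1) dist_in_closed_segment[of z x y] by (intro mult_left_mono) (auto simp: dist_commute)
    finally show ?thesis .
  qed
  have "\<bar>zext \<Omega> u x - zext \<Omega> u y\<bar> \<le> K * dist x y" for x y
    using K(1) K(2)[of x y] out[of x y] out[of y x] closure_subset[of \<Omega>]
    by (auto simp: zext_def dist_commute)
  then show ?thesis using that by blast
qed

lemma continuous_on_of_lipschitz:
  fixes u :: "pt \<Rightarrow> real"
  assumes "\<And>x y. \<bar>u x - u y\<bar> \<le> K * dist x y"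
  shows "continuous_on X u"
proof -
  have "\<bar>K\<bar>-lipschitz_on X u"
  proof (rule lipschitz_onI)
    fix x y
    have "\<bar>u x - u y\<bar> \<le> K * dist x y" by (rule assms)
    also have "\<dots> \<le> \<bar>K\<bar> * dist x y" by (intro mult_right_mono) auto
    finally show "dist (u x) (u y) \<le> \<bar>K\<bar> * dist x y" by (simp add: dist_real_def)
  qed simp
  then show ?thesis by (rule lipschitz_on_continuous_on)
qed

lemma C1alpha0_zext_closure:
  "C1alpha0 \<Omega> \<alpha> u \<Longrightarrow> x \<in> closure \<Omega> \<Longrightarrow> open \<Omega> \<Longrightarrow> zext \<Omega> u x = u x"
  by (auto simp: zext_def C1alpha0_def frontier_def interior_open)

text \<open>The admissible parameters form a closed bounded set, so the supremum is attained;
  convexity of the closure fills the interval below it.\<close>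

lemma tau_plus_iff:
  assumes "bounded \<Omega>" "convex \<Omega>" "x \<in> closure \<Omega>" "norm \<theta> = 1" "t \<ge> 0"
  shows "x + t *\<^sub>R \<theta> \<in> closure \<Omega> \<longleftrightarrow> t \<le> tau_plus \<Omega> x \<theta>"
proof -
  define S where "S = {t. t \<ge> 0 \<and> x + t *\<^sub>R \<theta> \<in> closure \<Omega>}"
  obtain B where B: "\<And>y. y \<in> closure \<Omega> \<Longrightarrow> norm y \<le> B"
    using bounded_closure[OF assms(1)] unfolding bounded_iff by blast
  have bdd: "s \<le> B + norm x" if "s \<in> S" for s
  proof -
    have "s = norm ((x + s *\<^sub>R \<theta>) - x)" using that assms(4) by (simp add: S_def)
    also have "\<dots> \<le> norm (x + s *\<^sub>R \<theta>) + norm x" by (rule norm_triangle_ineq4)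
    finally show ?thesis using B[of "x + s *\<^sub>R \<theta>"] that by (simp add: S_def)
  qed
  then have bdd': "bdd_above S" by (auto simp: bdd_above_def)
  have "0 \<in> S" using assms(3) by (simp add: S_def)
  have "closed S"
  proof -
    have "S = {0..} \<inter> (\<lambda>t. x + t *\<^sub>R \<theta>) -` closure \<Omega>" by (auto simp: S_def)
    then show ?thesis by (auto intro!: closed_Int closed_vimage continuous_intros)
  qed
  then have "Sup S \<in> S" using \<open>0 \<in> S\<close> bdd' by (intro closed_contains_Sup) auto
  define T where "T = Sup S"
  have T: "T \<ge> 0" "x + T *\<^sub>R \<theta> \<in> closure \<Omega>" using \<open>Sup S \<in> S\<close> by (auto simp: S_def T_def)
  have "x + t *\<^sub>R \<theta> \<in> closure \<Omega>" if "t \<le> T"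
  proof (cases "T = 0")
    case True
    then show ?thesis using that assms by simp
  next
    case False
    have "(1 - t / T) *\<^sub>R x + (t / T) *\<^sub>R (x + T *\<^sub>R \<theta>) \<in> closure \<Omega>"
      using that T False assms(5) by (intro convexD[OF convex_closure[OF assms(2)] assms(3)]) auto
    then show ?thesis using False by (simp add: algebra_simps)
  qed
  moreover have "t \<le> T" if "x + t *\<^sub>R \<theta> \<in> closure \<Omega>"
    unfolding T_def using that assms(5) bdd' by (intro cSup_upper) (auto simp: S_def)
  ultimately show ?thesis by (auto simp: tau_plus_def T_def S_def)
qed

text \<open>Lets the integrals over chords in \<open>att_data\<close> be read as integrals over full
  lines.\<close>

lemma chord_iff:
  assumes "bounded \<Omega>" "convex \<Omega>" "x \<in> closure \<Omega>" "norm \<theta> = 1"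
  shows "x + t *\<^sub>R \<theta> \<in> closure \<Omega> \<longleftrightarrow> t \<in> {- tau_minus \<Omega> x \<theta>..tau_plus \<Omega> x \<theta>}"
proof -
  have nn: "0 \<le> tau_plus \<Omega> x \<theta>" "0 \<le> tau_minus \<Omega> x \<theta>"
    using tau_plus_iff[OF assms order_refl] tau_plus_iff[OF assms(1,2,3), of "- \<theta>" 0] assms(3,4)
    by (auto simp: tau_minus_def)
  show ?thesis
  proof (cases "t \<ge> 0")
    case True
    then show ?thesis using tau_plus_iff[OF assms True] nn by auto
  next
    case False
    then show ?thesis using tau_plus_iff[OF assms(1,2,3), of "- \<theta>" "- t"] nn assms(4)
      by (auto simp: tau_minus_def)
  qed
qed

lemma integral_UNIV_translate:
  fixes h :: "real \<Rightarrow> real"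
  assumes "\<And>t. \<bar>t\<bar> > M \<Longrightarrow> h t = 0"
  shows "integral UNIV (\<lambda>t. h (t + c)) = integral UNIV h"
proof -
  have "integral UNIV (\<lambda>t. h (t + c)) = integral {- M - c..M - c} (\<lambda>t. h (t + c))"
    by (rule integral_eq_of_support) (auto intro!: assms)
  also have "\<dots> = integral {- M..M} h" by (rule integral_shift_real_ivl)
  also have "\<dots> = integral UNIV h" by (rule integral_eq_of_support) (auto intro!: assms)
  finally show ?thesis .
qed

text \<open>Directional derivatives alone do not give a Frechet derivative; here they only identify
  one known to exist, by linearity on multiples of unit vectors.\<close>

lemma has_derivative_eq_of_directional:
  fixes w :: "pt \<Rightarrow> real"
  assumes w: "(w has_derivative D) (at x)"
    and dir: "\<And>\<phi>. ((\<lambda>t. w (x + t *\<^sub>R dirvec \<phi>)) has_real_derivative G \<bullet> dirvec \<phi>) (at 0)"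
  shows "(w has_derivative (\<lambda>h. G \<bullet> h)) (at x)"
proof -
  have lin: "linear D" using w has_derivative_linear by blast
  have Ddir: "D (dirvec \<phi>) = G \<bullet> dirvec \<phi>" for \<phi>
  proof -
    have "((\<lambda>t. x + t *\<^sub>R dirvec \<phi>) has_derivative (\<lambda>t. t *\<^sub>R dirvec \<phi>)) (at 0)"
      by (auto intro!: derivative_eq_intros)
    from has_derivative_compose[OF this, of w D] w
    have "((\<lambda>t. w (x + t *\<^sub>R dirvec \<phi>)) has_derivative (\<lambda>t. D (t *\<^sub>R dirvec \<phi>))) (at 0)" by simp
    then have "((\<lambda>t. w (x + t *\<^sub>R dirvec \<phi>)) has_real_derivative D (dirvec \<phi>)) (at 0)"
      by (simp add: has_field_derivative_def linear_cmul[OF lin] mult_commute_abs)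
    then show ?thesis using dir DERIV_unique by blast
  qed
  have "D h = G \<bullet> h" for h
  proof (cases "h = 0")
    case False
    then obtain \<phi> where \<phi>: "(1 / norm h) *\<^sub>R h = dirvec \<phi>"
      using unit_vector_dirvec[of "(1 / norm h) *\<^sub>R h"] by auto
    then have "h = norm h *\<^sub>R dirvec \<phi>" using False by (simp flip: \<phi>)
    then show ?thesis using Ddir[of \<phi>] linear_cmul[OF lin, of "norm h" "dirvec \<phi>"] by (metis inner_scaleR_right real_scaleR_def)
  qed (simp add: linear_0[OF lin])
  then have "D = (\<lambda>h. G \<bullet> h)" by (rule ext)
  then show ?thesis using w by simp
qed

theorem mainTheorem8:
  fixes \<Omega> :: "(real^2) set" and \<alpha> :: real
    and a f :: "real^2 \<Rightarrow> real" and F :: "real^2 \<Rightarrow> real^2"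
    and g :: "real^2 \<Rightarrow> real^2 \<Rightarrow> real"
  assumes dom: "strictly_convex_smooth_domain \<Omega>"
    and alpha: "1/2 < \<alpha>" "\<alpha> < 1"
    and a_reg: "C1alpha0 \<Omega> \<alpha> a" and a_pos: "\<forall>x\<in>\<Omega>. a x > 0"
    and F_reg: "C1alpha0_vec \<Omega> \<alpha> F"
    and f_reg: "C1alpha0 \<Omega> \<alpha> f"
    and g_reg: "C_alpha_C1alpha_S1 (frontier \<Omega>) \<alpha> g"
    and g_D: "in_Da \<Omega> a F g"
    and g_R: "in_Ra \<Omega> a f g"
  shows "\<forall>x\<in>\<Omega>. ((\<lambda>y. f y / a y) has_derivative (\<lambda>h. - (F x \<bullet> h))) (at x)"
proof -
  have \<Omega>: "open \<Omega>" "bounded \<Omega>" "convex \<Omega>" using dom by (auto simp: strictly_convex_smooth_domain_def)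
  have "\<alpha> > 0" using alpha by simp
  define A where "A = zext \<Omega> a"
  define f0 where "f0 = zext \<Omega> f"
  define F0 where "F0 = zext \<Omega> F"
  obtain L where L: "\<And>x y. \<bar>A x - A y\<bar> \<le> L * dist x y"
    using zext_lipschitz[OF \<Omega> \<open>\<alpha> > 0\<close> a_reg] unfolding A_def by blast
  have cf: "continuous_on UNIV f0"
    using zext_lipschitz[OF \<Omega> \<open>\<alpha> > 0\<close> f_reg] continuous_on_of_lipschitz unfolding f0_def by metis
  have F_comp: "C1alpha0 \<Omega> \<alpha> (\<lambda>x. F x $ i)" for i using F_reg by (simp add: C1alpha0_vec_def)
  have "continuous_on UNIV (\<lambda>x. F0 x $ i)" for i
  proof -
    have "(\<lambda>x. F0 x $ i) = zext \<Omega> (\<lambda>x. F x $ i)" by (auto simp: F0_def zext_def)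
    then show ?thesis using zext_lipschitz[OF \<Omega> \<open>\<alpha> > 0\<close> F_comp[of i]] continuous_on_of_lipschitz by metis
  qed
  then have "continuous_on UNIV (\<lambda>x. \<chi> i. F0 x $ i)" by (intro continuous_on_vec_lambda)
  then have cF: "continuous_on UNIV F0" by simp
  obtain B where B: "\<And>x. x \<in> \<Omega> \<Longrightarrow> norm x \<le> B" using \<Omega>(2) unfolding bounded_iff by blast
  \<comment> \<open>Adding 1 makes \<open>R\<close> positive and puts every point of norm at least
    \<open>R\<close> strictly outside the domain.\<close>
  define R where "R = \<bar>B\<bar> + 1"
  have out: "x \<notin> \<Omega>" if "R \<le> norm x" for x using B[of x] that by (auto simp: R_def)
  interpret P: plane_attenuation A L R
    by unfold_locales (use L out in \<open>auto simp: A_def zext_def R_def\<close>)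
  have beam: "P.beam x \<phi> = Dbeam \<Omega> a x (dirvec \<phi>)" for x \<phi>
    unfolding P.beam_def by (simp add: Dbeam_def A_def zext_def)
  define G where "G = (\<lambda>x \<phi>. (dirvec \<phi> \<bullet> F0 x - f0 x) * exp (- P.beam x \<phi>))"
  have G_out: "G x \<phi> = 0" if "x \<notin> \<Omega>" for x \<phi> using that by (simp add: G_def F0_def f0_def zext_def)
  have chord: "integral UNIV (\<lambda>t. G (y + t *\<^sub>R dirvec \<phi>) \<phi>) = 0" if y: "y \<in> closure \<Omega>" for y \<phi>
  proof -
    define I where "I = {- tau_minus \<Omega> y (dirvec \<phi>)..tau_plus \<Omega> y (dirvec \<phi>)}"
    have I: "y + t *\<^sub>R dirvec \<phi> \<in> closure \<Omega> \<longleftrightarrow> t \<in> I" for t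
      unfolding I_def by (rule chord_iff[OF \<Omega>(2,3) y]) simp
    let ?E = "\<lambda>t. exp (- Dbeam \<Omega> a (y + t *\<^sub>R dirvec \<phi>) (dirvec \<phi>))"
    \<comment> \<open>Both integrals equal the same expression in \<open>g\<close>, which thereby
      drops out.\<close>
    have "integral I (\<lambda>t. (dirvec \<phi> \<bullet> F (y + t *\<^sub>R dirvec \<phi>)) * ?E t) = integral I (\<lambda>t. f (y + t *\<^sub>R dirvec \<phi>) * ?E t)"
      unfolding I_def
      by (rule trans[OF g_D[unfolded in_Da_def att_data_def, rule_format, OF y norm_dirvec, symmetric]
            g_R[unfolded in_Ra_def att_data_def, rule_format, OF y norm_dirvec]])
    moreover have "integral I (\<lambda>t. (dirvec \<phi> \<bullet> F (y + t *\<^sub>R dirvec \<phi>)) * ?E t)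
       = integral I (\<lambda>t. (dirvec \<phi> \<bullet> F0 (y + t *\<^sub>R dirvec \<phi>)) * exp (- P.beam (y + t *\<^sub>R dirvec \<phi>) \<phi>))"
    proof (rule Henstock_Kurzweil_Integration.integral_cong)
      fix t assume "t \<in> I"
      then have "y + t *\<^sub>R dirvec \<phi> \<in> closure \<Omega>" by (simp add: I)
      then have "F0 (y + t *\<^sub>R dirvec \<phi>) $ i = F (y + t *\<^sub>R dirvec \<phi>) $ i" for i
        using C1alpha0_zext_closure[OF F_comp[of i] _ \<Omega>(1), of "y + t *\<^sub>R dirvec \<phi>"]
        by (auto simp: F0_def zext_def split: if_splits)
      then have "F0 (y + t *\<^sub>R dirvec \<phi>) = F (y + t *\<^sub>R dirvec \<phi>)" by (simp add: vec_eq_iff)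
      then show "(dirvec \<phi> \<bullet> F (y + t *\<^sub>R dirvec \<phi>)) * ?E t
        = (dirvec \<phi> \<bullet> F0 (y + t *\<^sub>R dirvec \<phi>)) * exp (- P.beam (y + t *\<^sub>R dirvec \<phi>) \<phi>)" by (simp add: beam)
    qed
    moreover have "integral I (\<lambda>t. f (y + t *\<^sub>R dirvec \<phi>) * ?E t)
       = integral I (\<lambda>t. f0 (y + t *\<^sub>R dirvec \<phi>) * exp (- P.beam (y + t *\<^sub>R dirvec \<phi>) \<phi>))"
      using C1alpha0_zext_closure[OF f_reg _ \<Omega>(1)]
      by (intro Henstock_Kurzweil_Integration.integral_cong) (simp add: beam f0_def flip: I)
    ultimately have "integral I (\<lambda>t. (dirvec \<phi> \<bullet> F0 (y + t *\<^sub>R dirvec \<phi>)) * exp (- P.beam (y + t *\<^sub>R dirvec \<phi>) \<phi>))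
        - integral I (\<lambda>t. f0 (y + t *\<^sub>R dirvec \<phi>) * exp (- P.beam (y + t *\<^sub>R dirvec \<phi>) \<phi>)) = 0" by simp
    then have "integral I (\<lambda>t. G (y + t *\<^sub>R dirvec \<phi>) \<phi>) = 0"
      unfolding G_def left_diff_distrib I_def
      by (subst Henstock_Kurzweil_Integration.integral_diff)
         (auto intro!: integrable_continuous_real continuous_intros P.continuous_beam_comp
            continuous_on_compose2[OF cf] continuous_on_compose2[OF cF])
    moreover have "integral I (\<lambda>t. G (y + t *\<^sub>R dirvec \<phi>) \<phi>) = integral UNIV (\<lambda>t. G (y + t *\<^sub>R dirvec \<phi>) \<phi>)"
    proof (rule integral_eq_of_support)
      fix t assume "t \<notin> I"
      then show "G (y + t *\<^sub>R dirvec \<phi>) \<phi> = 0" using closure_subset[of \<Omega>] by (intro G_out) (auto simp flip: I)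
    qed auto
    ultimately show ?thesis by simp
  qed
  \<comment> \<open>\<open>chord\<close> needs a base point in the closure. A line that meets the
    domain is reparametrised from a point inside it; on any other line the integrand is 0.\<close>
  have ray: "integral UNIV (\<lambda>t. G (x + t *\<^sub>R dirvec \<phi>) \<phi>) = 0" for x \<phi>
  proof (cases "\<exists>c. x + c *\<^sub>R dirvec \<phi> \<in> \<Omega>")
    case True
    then obtain c where c: "x + c *\<^sub>R dirvec \<phi> \<in> \<Omega>" by blast
    have "integral UNIV (\<lambda>t. G (x + (t + c) *\<^sub>R dirvec \<phi>) \<phi>) = integral UNIV (\<lambda>t. G (x + t *\<^sub>R dirvec \<phi>) \<phi>)"
      by (rule integral_UNIV_translate[of "norm x + R"]) (auto intro!: G_out out norm_add_scaleR_dirvec_ge)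
    then show ?thesis using chord[of "x + c *\<^sub>R dirvec \<phi>" \<phi>] c closure_subset[of \<Omega>] by (auto simp: algebra_simps)
  next
    case False
    then show ?thesis using G_out by simp
  qed
  interpret Q: attenuated_pair A L R f0 F0
    by unfold_locales (use cf cF out ray in \<open>auto simp: f0_def F0_def zext_def G_def\<close>)
  obtain v where v: "\<And>x. A x * v x = - f0 x"
    "\<And>x \<phi>. ((\<lambda>t. v (x + t *\<^sub>R dirvec \<phi>)) has_real_derivative dirvec \<phi> \<bullet> F0 x) (at 0)"
    using Q.potential_exists by blast
  show ?thesis
  proof
    fix x assume x: "x \<in> \<Omega>"
    have quot: "f y / a y = - v y" if "y \<in> \<Omega>" for y
    proof -
      have "a y > 0" "f y = - v y * a y" using v(1)[of y] a_pos that
        by (auto simp: A_def f0_def zext_def mult.commute)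
      then show ?thesis by simp
    qed
    \<comment> \<open>Differentiability of the quotient comes from \<open>f\<close> and
      \<open>a\<close> with \<open>a x\<close> nonzero; the potential \<open>v\<close> only supplies
      the values of the derivative.\<close>
    obtain a' where a': "(a has_derivative a') (at x)" using a_reg x unfolding C1alpha0_def by blast
    obtain f' where f': "(f has_derivative f') (at x)" using f_reg x unfolding C1alpha0_def by blast
    have "a x \<noteq> 0" using a_pos x by force
    from has_derivative_divide'[OF f' a' this]
    obtain D where D: "((\<lambda>y. f y / a y) has_derivative D) (at x)" by blast
    have "((\<lambda>t. f (x + t *\<^sub>R dirvec \<phi>) / a (x + t *\<^sub>R dirvec \<phi>)) has_real_derivative - F x \<bullet> dirvec \<phi>) (at 0)" for \<phi>
    proof -
      \<comment> \<open>The identity between \<open>f / a\<close> and \<open>- v\<close> is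
        available only inside the domain, where the line stays for small \<open>t\<close>.\<close>
      have "open ((\<lambda>t. x + t *\<^sub>R dirvec \<phi>) -` \<Omega>)"
        by (intro open_vimage \<Omega>(1) continuous_intros)
      then have "\<forall>\<^sub>F t in nhds 0. t \<in> (\<lambda>t. x + t *\<^sub>R dirvec \<phi>) -` \<Omega>"
        by (rule eventually_nhds_in_open) (use x in simp)
      then have ev: "\<forall>\<^sub>F t in nhds 0. f (x + t *\<^sub>R dirvec \<phi>) / a (x + t *\<^sub>R dirvec \<phi>) = - v (x + t *\<^sub>R dirvec \<phi>)"
        by eventually_elim (simp add: quot)
      have "((\<lambda>t. - v (x + t *\<^sub>R dirvec \<phi>)) has_real_derivative - (dirvec \<phi> \<bullet> F0 x)) (at 0)"
        by (intro DERIV_minus v(2))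
      then show ?thesis
        using DERIV_cong_ev[OF refl ev refl] x by (simp add: F0_def zext_def inner_commute)
    qed
    from has_derivative_eq_of_directional[OF D this]
    show "((\<lambda>y. f y / a y) has_derivative (\<lambda>h. - (F x \<bullet> h))) (at x)" by simp
  qed
qed

end
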